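(* Let $\mathcal I$ in $\mathbb C\langle x_1,\dots,x_d\rangle$ and $\mathcal J$ in $\mathbb C\langle y_1,\dots,y_{d'}\rangle$ be monomial ideals. If their quantised dynamics are $Q$-$P$-locally piecewise conjugate then $C^*(T)\simeq C^*(R)$, and moreover $C^*(T)/\mathcal K(\mathcal F_X)\simeq C^*(R)/\mathcal K(\mathcal F_Y)$ ($*$-isomorphisms).
   Context: $\mathbb F_+^d$ is the free monoid of words in $\{1,\dots,d\}$, with empty word $\emptyset$; $x^\mu=x_{\mu_1}\cdots x_{\mu_n}\in\mathbb C\langle x_1,\dots,x_d\rangle$ (noncommuting variables). A monomial ideal is a two-sided ideal generated by monomials; throughout, monomial ideals are generated by monomials of degree at least 2 (the zero ideal is allowed). For a monomial ideal $\mathcal I$: $\Lambda^*=\{\mu: x^\mu\notin\mathcal I\}$; $\mathcal F_X$ is the Hilbert space with orthonormal basis $\{e_\mu:\mu\in\Lambda^*\}$; $T_ie_\nu=e_{i\nu}$ if $i\nu\in\Lambda^*$, $T_ie_\nu=0$ otherwise; $T_\mu=T_{\mu_1}\cdots T_{\mu_n}$, $T_\emptyset=I$. $C^*(T)$ is the C*-algebra generated by $I,T_1,\dots,T_d$; it contains the compacts $\mathcal K(\mathcal F_X)$. For $\mathcal J$ the corresponding objects are $\mathcal F_Y$, $R_i$, $C^*(R)$. Quantised dynamics. $A=C^*(T_\mu^*T_\mu:\mu\in\Lambda^* )$ is unital commutative and $\alpha_i(a)=T_i^*aT_i$ are $*$-endomorphisms of $A$. $\Omega_{\mathcal I}$ is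 the Gelfand spectrum of $A$, $\Omega_{\mathcal I}^i$ the clopen subset corresponding to the projection $T_i^*T_i$, and $\varphi_i:\Omega^i_{\mathcal I}\to\Omega_{\mathcal I}$ the continuous map with $\alpha_i(a)=a\circ\varphi_i$ on $\Omega_{\mathcal I}^i$ and $0$ off it. The quantised dynamics of $\mathcal I$ are $(\Omega_{\mathcal I},\varphi_1,\dots,\varphi_d)$. For $S\subseteq\{1,\dots,d\}$ let $Q_S=\{\omega\in\Omega_{\mathcal I}:\omega\in\Omega_{\mathcal I}^i\iff i\in S\}$. For $\mathcal J$ write $\Omega_{\mathcal J}$, $\Omega^i_{\mathcal J}$, $\psi_i$, $P_S$. $(\Omega_{\mathcal I},\varphi)$ and $(\Omega_{\mathcal J},\psi)$ (with $d=d'$) are $Q$-$P$-locally piecewise conjugate if there is a homeomorphism $\gamma_s:\Omega_{\mathcal J}\to\Omega_{\mathcal I}$ such that for every $S\subseteq\{1,\dots,d\}$ and $y\in P_S$ there are a neighbourhood $\mathcal U\subseteq P_S$ of $y$, a set $S'\subseteq\{1,\dots,d\}$ with $|S'|=|S|$ and $\gamma_s(\mathcal U)\subseteq Q_{S'}$, and a bijection $\pi:S\to S'$ with $\gamma_s\psi_i|_{\mathcal U}=\varphi_{\pi(i)}\gamma_s|_{\mathcal U}$ for all $i\in S$. *)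

theory Defs
  imports
    "HOL-Analysis.Analysis"
    "HOL-Algebra.QuotRing"
    "HOL-Algebra.Module"
    "HOL-Library.Poly_Mapping"
begin

section \<open>Monomial ideals\<close>

text \<open>Words form a monoid under concatenation. The library builds the monoid algebra
  of \<open>'m\<close> on \<open>'m \<Rightarrow>\<^sub>0 'c\<close> from an additively written monoid,
  so concatenation has to be called \<open>+\<close> here; it is not commutative.\<close>

instantiation list :: (type) monoid_add
begin
definition zero_list :: "'a list" where "zero_list = []"
definition plus_list :: "'a list \<Rightarrow> 'a list \<Rightarrow> 'a list" where "plus_list u v = u @ v"
instance by standard (simp_all add: zero_list_def plus_list_def)
end

definition words :: "nat \<Rightarrow> nat list set"
  where "words d = lists {1..d}"

definition free_algebra :: "nat \<Rightarrow> (nat list \<Rightarrow>\<^sub>0 complex) ring"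
  where "free_algebra d =
    \<lparr>carrier = {f. Poly_Mapping.keys f \<subseteq> words d}, mult = (*), one = 1, zero = 0, add = (+)\<rparr>"

definition monomial :: "nat list \<Rightarrow> (nat list \<Rightarrow>\<^sub>0 complex)"
  where "monomial \<mu> = Poly_Mapping.single \<mu> 1"

lemma monomial_Nil: "monomial [] = 1"
  by (simp add: monomial_def single_one flip: zero_list_def)

lemma monomial_append: "monomial (\<mu> @ \<nu>) = monomial \<mu> * monomial \<nu>"
  by (simp add: monomial_def mult_single plus_list_def)

lemma ring_free_algebra: "ring (free_algebra d)"
proof (rule ringI)
  have mult: "Poly_Mapping.keys (f * g) \<subseteq> words d"
    if "Poly_Mapping.keys f \<subseteq> words d" "Poly_Mapping.keys g \<subseteq> words d"
    for f g :: "nat list \<Rightarrow>\<^sub>0 complex"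
    using keys_mult[of f g] that by (fastforce simp: words_def plus_list_def)
  have add: "Poly_Mapping.keys (f + g) \<subseteq> words d"
    if "Poly_Mapping.keys f \<subseteq> words d" "Poly_Mapping.keys g \<subseteq> words d"
    for f g :: "nat list \<Rightarrow>\<^sub>0 complex"
    using Poly_Mapping.keys_add[of f g] that by blast
  have one: "Poly_Mapping.keys (1 :: nat list \<Rightarrow>\<^sub>0 complex) \<subseteq> words d"
    by (simp add: words_def zero_list_def)
  show "abelian_group (free_algebra d)"
  proof (rule abelian_groupI)
    fix f assume "f \<in> carrier (free_algebra d)"
    then show "\<exists>g\<in>carrier (free_algebra d). g \<oplus>\<^bsub>free_algebra d\<^esub> f = \<zero>\<^bsub>free_algebra d\<^esub>"
      by (intro bexI[of _ "- f"]) (simp_all add: free_algebra_def)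
  qed (use add in \<open>auto simp: free_algebra_def algebra_simps\<close>)
  show "Group.monoid (free_algebra d)"
    by (rule Group.monoidI) (use mult one in \<open>auto simp: free_algebra_def algebra_simps\<close>)
qed (auto simp: free_algebra_def algebra_simps)

definition monomial_ideal :: "nat \<Rightarrow> (nat list \<Rightarrow>\<^sub>0 complex) set \<Rightarrow> bool"
  where "monomial_ideal d I \<longleftrightarrow>
    (\<exists>G \<subseteq> words d. (\<forall>\<mu>\<in>G. 2 \<le> length \<mu>) \<and> I = Idl\<^bsub>free_algebra d\<^esub> (monomial ` G))"

definition allowed_words :: "nat \<Rightarrow> (nat list \<Rightarrow>\<^sub>0 complex) set \<Rightarrow> nat list set"
  where "allowed_words d I = {\<mu> \<in> words d. monomial \<mu> \<notin> I}"


section \<open>The Hilbert space of square-summable families\<close>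

typedef 'a ell2 = "{f :: 'a \<Rightarrow> complex. (\<lambda>x. (cmod (f x))\<^sup>2) summable_on UNIV}"
  by (rule exI[of _ "\<lambda>_. 0"]) simp

setup_lifting type_definition_ell2

lemma ell2_comparison:
  fixes f :: "'a \<Rightarrow> 'b :: {banach}" and g :: "'a \<Rightarrow> real"
  assumes "g summable_on A" "\<And>x. x \<in> A \<Longrightarrow> norm (f x) \<le> g x"
  shows "f summable_on A"
  by (rule abs_summable_summable, rule Infinite_Sum.abs_summable_on_comparison_test'[OF assms])

lemma ell2_prod_bound: "cmod a * cmod b \<le> (cmod a)\<^sup>2 + (cmod b)\<^sup>2"
proof -
  have "0 \<le> (cmod a - cmod b)\<^sup>2" "0 \<le> (cmod a)\<^sup>2 + (cmod b)\<^sup>2" by auto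
  then show ?thesis unfolding power2_diff by linarith
qed

lemma ell2_add_bound: "(cmod (a + b))\<^sup>2 \<le> 2 * (cmod a)\<^sup>2 + 2 * (cmod b)\<^sup>2"
proof -
  have "(cmod (a + b))\<^sup>2 \<le> (cmod a + cmod b)\<^sup>2" by (simp add: norm_triangle_ineq power_mono)
  moreover have "0 \<le> (cmod a - cmod b)\<^sup>2" by auto
  ultimately show ?thesis unfolding power2_diff power2_sum by linarith
qed

instantiation ell2 :: (type) ab_group_add
begin

lift_definition zero_ell2 :: "'a ell2" is "\<lambda>_. 0" by simp

lift_definition plus_ell2 :: "'a ell2 \<Rightarrow> 'a ell2 \<Rightarrow> 'a ell2" is "\<lambda>f g x. f x + g x"
proof -
  fix f g :: "'a \<Rightarrow> complex"
  assume "(\<lambda>x. (cmod (f x))\<^sup>2) summable_on UNIV" "(\<lambda>x. (cmod (g x))\<^sup>2) summable_on UNIV"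
  then have "(\<lambda>x. 2 * (cmod (f x))\<^sup>2 + 2 * (cmod (g x))\<^sup>2) summable_on UNIV"
    by (intro summable_on_add summable_on_cmult_right)
  then show "(\<lambda>x. (cmod (f x + g x))\<^sup>2) summable_on UNIV"
    by (rule ell2_comparison) (simp add: ell2_add_bound)
qed

lift_definition uminus_ell2 :: "'a ell2 \<Rightarrow> 'a ell2" is "\<lambda>f x. - f x" by simp

definition minus_ell2 :: "'a ell2 \<Rightarrow> 'a ell2 \<Rightarrow> 'a ell2" where "minus_ell2 f g = f + (- g)"

instance by standard (transfer; auto simp: minus_ell2_def)+

end

lift_definition scaleC :: "complex \<Rightarrow> 'a ell2 \<Rightarrow> 'a ell2" (infixr \<open>*\<^sub>C\<close> 75) is "\<lambda>c f x. c * f x"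
  by (simp add: norm_mult power_mult_distrib summable_on_cmult_right)

lift_definition cinner :: "'a ell2 \<Rightarrow> 'a ell2 \<Rightarrow> complex"
  is "\<lambda>f g. \<Sum>\<^sub>\<infinity>x. cnj (f x) * g x" .

lemma ell2_cinner_summable:
  "(\<lambda>x. cnj (Rep_ell2 f x) * Rep_ell2 g x) summable_on UNIV"
proof (rule ell2_comparison)
  show "(\<lambda>x. (cmod (Rep_ell2 f x))\<^sup>2 + (cmod (Rep_ell2 g x))\<^sup>2) summable_on UNIV"
    using Rep_ell2[of f] Rep_ell2[of g] by (auto intro!: summable_on_add)
qed (simp add: norm_mult ell2_prod_bound)

lemma cinner_commute: "cinner f g = cnj (cinner g f)"
  unfolding cinner.rep_eq infsum_cnj[symmetric] by (simp add: mult.commute)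

lemma cinner_add_right: "cinner f (g + h) = cinner f g + cinner f h"
  unfolding cinner.rep_eq plus_ell2.rep_eq
  by (simp add: distrib_left infsum_add ell2_cinner_summable)

lemma cinner_scaleC_right: "cinner f (c *\<^sub>C g) = c * cinner f g"
proof -
  have "(\<Sum>\<^sub>\<infinity>x. cnj (Rep_ell2 f x) * (c * Rep_ell2 g x))
      = (\<Sum>\<^sub>\<infinity>x. c * (cnj (Rep_ell2 f x) * Rep_ell2 g x))"
    by (simp add: algebra_simps)
  then show ?thesis
    unfolding cinner.rep_eq scaleC.rep_eq by (simp add: infsum_cmult_right')
qed

lemma cinner_add_left: "cinner (f + g) h = cinner f h + cinner g h"
  by (metis cinner_add_right cinner_commute complex_cnj_add)

lemma cinner_scaleC_left: "cinner (c *\<^sub>C f) g = cnj c * cinner f g"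
  by (metis cinner_commute cinner_scaleC_right complex_cnj_cnj complex_cnj_mult)

lemma cinner_self: "cinner f f = of_real (\<Sum>\<^sub>\<infinity>x. (cmod (Rep_ell2 f x))\<^sup>2)"
proof -
  have "(\<lambda>x. (cmod (Rep_ell2 f x))\<^sup>2) summable_on UNIV" using Rep_ell2[of f] by auto
  then have "((\<lambda>x. complex_of_real ((cmod (Rep_ell2 f x))\<^sup>2)) has_sum
      of_real (\<Sum>\<^sub>\<infinity>x. (cmod (Rep_ell2 f x))\<^sup>2)) UNIV"
    by (intro has_sum_of_real has_sum_infsum)
  moreover have "cnj z * z = complex_of_real ((cmod z)\<^sup>2)" for z
    by (metis complex_norm_square mult.commute)
  ultimately show ?thesis
    unfolding cinner.rep_eq by (simp add: infsumI)
qed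

instantiation ell2 :: (type) real_vector
begin

definition scaleR_ell2 :: "real \<Rightarrow> 'a ell2 \<Rightarrow> 'a ell2" where "scaleR_ell2 r f = of_real r *\<^sub>C f"

instance
  by standard (unfold scaleR_ell2_def, (transfer; simp add: algebra_simps)+)

end

instantiation ell2 :: (type) real_inner
begin

definition inner_ell2 :: "'a ell2 \<Rightarrow> 'a ell2 \<Rightarrow> real" where "inner_ell2 f g = Re (cinner f g)"
definition norm_ell2 :: "'a ell2 \<Rightarrow> real" where "norm_ell2 f = sqrt (inner f f)"
definition dist_ell2 :: "'a ell2 \<Rightarrow> 'a ell2 \<Rightarrow> real" where "dist_ell2 f g = norm (f - g)"
definition sgn_ell2 :: "'a ell2 \<Rightarrow> 'a ell2" where "sgn_ell2 f = f /\<^sub>R norm f"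
definition uniformity_ell2 :: "('a ell2 \<times> 'a ell2) filter"
  where [code del]: "uniformity_ell2 = (INF e\<in>{0 <..}. principal {(f, g). dist f g < e})"
definition open_ell2 :: "'a ell2 set \<Rightarrow> bool"
  where [code del]: "open_ell2 S =
    (\<forall>f\<in>S. \<forall>\<^sub>F (f', g) in uniformity. f' = f \<longrightarrow> g \<in> S)"

instance
proof
  fix f g h :: "'a ell2" and r :: real
  show "dist f g = norm (f - g)" "sgn f = f /\<^sub>R norm f" "norm f = sqrt (inner f f)"
    by (simp_all add: dist_ell2_def sgn_ell2_def norm_ell2_def)
  show "(uniformity :: ('a ell2 \<times> 'a ell2) filter)
      = (INF e\<in>{0 <..}. principal {(f, g). dist f g < e})"
    by (rule uniformity_ell2_def)
  show "open S = (\<forall>f\<in>S. \<forall>\<^sub>F (f', g) in uniformity. f' = f \<longrightarrow> g \<in> S)" for S :: "'a ell2 set"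
    by (rule open_ell2_def)
  show "inner f g = inner g f"
    unfolding inner_ell2_def by (metis cinner_commute complex_cnj(1) complex.collapse complex.sel(1))
  show "inner (f + g) h = inner f h + inner g h"
    by (simp add: inner_ell2_def cinner_add_left)
  show "inner (r *\<^sub>R f) g = r * inner f g"
    by (simp add: inner_ell2_def scaleR_ell2_def cinner_scaleC_left)
  show "0 \<le> inner f f"
    by (simp add: inner_ell2_def cinner_self infsum_nonneg)
  show "inner f f = 0 \<longleftrightarrow> f = 0"
  proof
    assume "inner f f = 0"
    then have *: "(\<Sum>\<^sub>\<infinity>x. (cmod (Rep_ell2 f x))\<^sup>2) = 0"
      by (simp add: inner_ell2_def cinner_self)
    have "(cmod (Rep_ell2 f x))\<^sup>2 = 0" for x
      by (rule nonneg_infsum_le_0D[of _ UNIV]) (use * Rep_ell2[of f] in auto)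
    then show "f = 0"
      by (metis (no_types) Rep_ell2_inject ext norm_eq_zero zero_ell2.rep_eq zero_eq_power2)
  qed (simp add: inner_ell2_def cinner.rep_eq zero_ell2.rep_eq)
qed

end

lemma norm_ell2_sq: "(norm f)\<^sup>2 = (\<Sum>\<^sub>\<infinity>x. (cmod (Rep_ell2 f x))\<^sup>2)"
  by (simp add: norm_ell2_def inner_ell2_def cinner_self infsum_nonneg)

lemma norm_scaleC: "norm (c *\<^sub>C f) = cmod c * norm f"
proof -
  have "cinner (c *\<^sub>C f) (c *\<^sub>C f) = complex_of_real ((cmod c)\<^sup>2) * cinner f f"
    unfolding cinner_scaleC_left cinner_scaleC_right
    by (metis complex_norm_square mult.assoc mult.commute)
  then show ?thesis
    by (simp add: norm_eq_sqrt_inner inner_ell2_def real_sqrt_mult)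
qed

lemma cinner_Cauchy_Schwarz: "cmod (cinner f g) \<le> norm f * norm g"
proof (cases "cinner f g = 0")
  case False
  define c where "c = cnj (cinner f g) / of_real (cmod (cinner f g))"
  have "cmod c = 1" using False by (simp add: c_def norm_divide)
  have "c * cinner f g = of_real (cmod (cinner f g))"
    using False unfolding c_def
    by (simp add: complex_norm_square power2_eq_square field_simps flip: complex_norm_square)
  then have "cmod (cinner f g) = inner f (c *\<^sub>C g)"
    by (simp add: inner_ell2_def cinner_scaleC_right)
  also have "\<dots> \<le> norm f * norm (c *\<^sub>C g)" by (rule norm_cauchy_schwarz)
  finally show ?thesis using \<open>cmod c = 1\<close> by (simp add: norm_scaleC)
qed simp


lemma ell2_complete:
  fixes X :: "nat \<Rightarrow> 'a ell2"
  assumes "Cauchy X"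
  shows "convergent X"
proof -
  have coord: "cmod (Rep_ell2 f x) \<le> norm f" for f :: "'a ell2" and x
  proof -
    have "sum (\<lambda>x. (cmod (Rep_ell2 f x))\<^sup>2) {x} \<le> (\<Sum>\<^sub>\<infinity>x. (cmod (Rep_ell2 f x))\<^sup>2)"
      using Rep_ell2[of f] by (intro finite_sum_le_infsum) auto
    then show ?thesis
      by (simp add: norm_ell2_sq[symmetric] abs_le_square_iff[symmetric])
  qed
  have minus: "Rep_ell2 (f - g) x = Rep_ell2 f x - Rep_ell2 g x" for f g :: "'a ell2" and x
    unfolding minus_ell2_def plus_ell2.rep_eq uminus_ell2.rep_eq by simp
  have "Cauchy (\<lambda>n. Rep_ell2 (X n) x)" for x
  proof (rule CauchyI)
    fix e :: real assume "0 < e"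
    then obtain M where "\<forall>m\<ge>M. \<forall>n\<ge>M. norm (X m - X n) < e"
      using CauchyD[OF assms] by blast
    then show "\<exists>M. \<forall>m\<ge>M. \<forall>n\<ge>M. cmod (Rep_ell2 (X m) x - Rep_ell2 (X n) x) < e"
      by (metis coord minus order_le_less_trans)
  qed
  then have "\<forall>x. \<exists>l. (\<lambda>n. Rep_ell2 (X n) x) \<longlonglongrightarrow> l"
    by (simp add: Cauchy_convergent_iff convergent_def)
  then obtain l where l: "\<And>x. (\<lambda>n. Rep_ell2 (X n) x) \<longlonglongrightarrow> l x" by metis
  have bound: "(\<Sum>x\<in>F. (cmod (Rep_ell2 (X m) x - l x))\<^sup>2) \<le> e\<^sup>2"
    if "finite F" "\<forall>n\<ge>M. norm (X m - X n) < e" for F m M e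
  proof (rule tendsto_upperbound)
    show "(\<lambda>n. \<Sum>x\<in>F. (cmod (Rep_ell2 (X m) x - Rep_ell2 (X n) x))\<^sup>2)
        \<longlonglongrightarrow> (\<Sum>x\<in>F. (cmod (Rep_ell2 (X m) x - l x))\<^sup>2)"
      by (intro tendsto_intros l)
    show "\<forall>\<^sub>F n in sequentially.
        (\<Sum>x\<in>F. (cmod (Rep_ell2 (X m) x - Rep_ell2 (X n) x))\<^sup>2) \<le> e\<^sup>2"
    proof (rule eventually_sequentiallyI)
      fix n assume "M \<le> n"
      have "(\<Sum>x\<in>F. (cmod (Rep_ell2 (X m - X n) x))\<^sup>2) \<le> (norm (X m - X n))\<^sup>2"
        unfolding norm_ell2_sq using Rep_ell2[of "X m - X n"] that(1)
        by (intro finite_sum_le_infsum) auto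
      also have "\<dots> \<le> e\<^sup>2" using that(2) \<open>M \<le> n\<close> by (intro power_mono) (auto simp: less_imp_le)
      finally show "(\<Sum>x\<in>F. (cmod (Rep_ell2 (X m) x - Rep_ell2 (X n) x))\<^sup>2) \<le> e\<^sup>2"
        by (simp add: minus)
    qed
  qed simp
  have diff: "(\<lambda>x. (cmod (Rep_ell2 (X m) x - l x))\<^sup>2) summable_on UNIV"
    if "\<forall>n\<ge>M. norm (X m - X n) < e" for m M e
    by (rule nonneg_bdd_above_summable_on) (use bound that in \<open>auto intro!: bdd_aboveI2\<close>)
  obtain M where M: "\<forall>m\<ge>M. \<forall>n\<ge>M. norm (X m - X n) < 1"
    using CauchyD[OF assms, of 1] by auto
  define d where "d = Abs_ell2 (\<lambda>x. Rep_ell2 (X M) x - l x)"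
  have d: "Rep_ell2 d x = Rep_ell2 (X M) x - l x" for x
    unfolding d_def using diff[of M M 1] M by (simp add: Abs_ell2_inverse)
  have limit: "Rep_ell2 (X M - d) x = l x" for x by (simp add: minus d)
  have "X \<longlonglongrightarrow> X M - d"
  proof (rule LIMSEQ_I)
    fix r :: real assume "0 < r"
    then obtain N where N: "\<forall>m\<ge>N. \<forall>n\<ge>N. norm (X m - X n) < r / 2"
      using CauchyD[OF assms, of "r / 2"] by auto
    have "norm (X m - (X M - d)) < r" if "N \<le> m" for m
    proof -
      have *: "\<forall>n\<ge>N. norm (X m - X n) < r / 2" using N that by blast
      have "(norm (X m - (X M - d)))\<^sup>2 = (\<Sum>\<^sub>\<infinity>x. (cmod (Rep_ell2 (X m) x - l x))\<^sup>2)"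
        by (simp only: norm_ell2_sq minus[of "X m"] limit)
      also have "\<dots> \<le> (r / 2)\<^sup>2"
        by (rule infsum_le_finite_sums[OF diff[OF *]]) (use bound[OF _ *] in auto)
      finally have "norm (X m - (X M - d)) \<le> r / 2"
        using \<open>0 < r\<close> by (simp add: abs_le_square_iff[symmetric])
      then show ?thesis using \<open>0 < r\<close> by linarith
    qed
    then show "\<exists>N. \<forall>n\<ge>N. norm (X n - (X M - d)) < r" by blast
  qed
  then show ?thesis unfolding convergent_def by blast
qed

instance ell2 :: (type) banach
  by standard (rule ell2_complete)

lift_definition ket :: "'a \<Rightarrow> 'a ell2" is "\<lambda>x y. if y = x then 1 else 0"
proof -
  fix x :: 'a
  have "(\<lambda>y. (cmod (if y = x then 1 else 0 :: complex))\<^sup>2) summable_on {x}" by simp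
  then show "(\<lambda>y. (cmod (if y = x then 1 else 0 :: complex))\<^sup>2) summable_on UNIV"
    by (rule summable_on_cong_neutral[THEN iffD1, rotated -1]) auto
qed

lemma cinner_ket: "cinner (ket x) f = Rep_ell2 f x"
proof -
  have "(\<Sum>\<^sub>\<infinity>y. cnj (if y = x then 1 else 0) * Rep_ell2 f y) = (\<Sum>\<^sub>\<infinity>y\<in>{x}. Rep_ell2 f y)"
    by (rule infsum_cong_neutral) auto
  then show ?thesis unfolding cinner.rep_eq ket.rep_eq by simp
qed

lemma Rep_ell2_sum: "Rep_ell2 (sum f F) x = (\<Sum>y\<in>F. Rep_ell2 (f y) x)"
  by (induction F rule: infinite_finite_induct) (auto simp: zero_ell2.rep_eq plus_ell2.rep_eq)

lemma Rep_ell2_truncation: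
  "finite F \<Longrightarrow> Rep_ell2 (\<Sum>x\<in>F. c x *\<^sub>C ket x) y = (if y \<in> F then c y else 0)"
  by (simp add: Rep_ell2_sum scaleC.rep_eq ket.rep_eq if_distrib cong: if_cong)

lemma ell2_truncation_approx:
  assumes "0 < e"
  shows "\<exists>F. finite F \<and> norm (f - (\<Sum>x\<in>F. Rep_ell2 f x *\<^sub>C ket x)) < e"
proof -
  let ?q = "\<lambda>x. (cmod (Rep_ell2 f x))\<^sup>2"
  have q: "?q summable_on UNIV" using Rep_ell2[of f] by auto
  obtain F where F: "finite F" "dist (sum ?q F) (infsum ?q UNIV) \<le> (e / 2)\<^sup>2"
    using infsum_finite_approximation[OF q, of "(e / 2)\<^sup>2"] assms by auto
  let ?t = "\<Sum>x\<in>F. Rep_ell2 f x *\<^sub>C ket x"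
  have "(norm (f - ?t))\<^sup>2 = (\<Sum>\<^sub>\<infinity>x. if x \<in> F then 0 else ?q x)"
    unfolding norm_ell2_sq minus_ell2_def plus_ell2.rep_eq uminus_ell2.rep_eq
      Rep_ell2_truncation[OF F(1)] by (rule infsum_cong) simp
  also have "\<dots> = infsum ?q (UNIV - F)"
    by (rule infsum_cong_neutral) auto
  also have "\<dots> = infsum ?q UNIV - sum ?q F"
    using infsum_Un_disjoint[of ?q F "UNIV - F"] F(1) q
    by (simp add: summable_on_subset_banach[OF q])
  also have "\<dots> \<le> (e / 2)\<^sup>2" using F(2) by (simp add: dist_real_def)
  finally have "norm (f - ?t) \<le> e / 2"
    using assms by (simp add: abs_le_square_iff[symmetric])
  then show ?thesis using F(1) assms by (intro exI[of _ F]) auto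
qed


section \<open>Operators\<close>

text \<open>For a set \<open>L\<close> of words, the Hilbert space with orthonormal basis \<open>(e\<^sub>\<mu>)\<close>, \<open>\<mu> \<in> L\<close>, is
  the closed subspace of \<open>\<ell>\<^sup>2\<close> of families supported on \<open>L\<close>, and its bounded operators are
  represented by the corner \<open>P B(\<ell>\<^sup>2) P\<close>, where \<open>P\<close> is the projection onto that subspace. In
  particular \<open>P\<close> plays the role of the identity. The type of bounded linear
  maps is about real-linear maps; complex linearity is imposed separately.\<close>

definition clinear_op :: "('a ell2 \<Rightarrow>\<^sub>L 'a ell2) \<Rightarrow> bool"
  where "clinear_op a \<longleftrightarrow> (\<forall>c f. a (c *\<^sub>C f) = c *\<^sub>C a f)"

definition scaleC_op :: "complex \<Rightarrow> ('a ell2 \<Rightarrow>\<^sub>L 'a ell2) \<Rightarrow> ('a ell2 \<Rightarrow>\<^sub>L 'a ell2)"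
  where "scaleC_op c a = Blinfun (\<lambda>f. c *\<^sub>C a f)"

definition adj :: "('a ell2 \<Rightarrow>\<^sub>L 'a ell2) \<Rightarrow> ('a ell2 \<Rightarrow>\<^sub>L 'a ell2)"
  where "adj a = (THE b. \<forall>f g. cinner (a f) g = cinner f (blinfun_apply b g))"

lemma scaleC_add: "c *\<^sub>C (f + g) = c *\<^sub>C f + c *\<^sub>C g"
  by transfer (simp add: algebra_simps)

lemma scaleC_scaleR: "c *\<^sub>C (r *\<^sub>R f) = r *\<^sub>R (c *\<^sub>C f)"
  unfolding scaleR_ell2_def by transfer (simp add: algebra_simps)

lemma scaleC_op_apply: "scaleC_op c a f = c *\<^sub>C a f"
proof -
  have "bounded_linear (\<lambda>f. c *\<^sub>C a f)"
  proof (rule bounded_linear_intro)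
    fix f
    show "norm (c *\<^sub>C a f) \<le> norm f * (norm a * cmod c)"
      using mult_left_mono[OF norm_blinfun[of a f], of "cmod c"] by (simp add: norm_scaleC mult_ac)
  qed (simp_all add: blinfun.add_right blinfun.scaleR_right scaleC_add scaleC_scaleR)
  then show ?thesis unfolding scaleC_op_def by (simp add: bounded_linear_Blinfun_apply)
qed

lemma adj_unique:
  fixes a b :: "'a ell2 \<Rightarrow>\<^sub>L 'a ell2"
  assumes "\<forall>f g. cinner (a f) g = cinner f (b g)"
  shows "adj a = b"
  unfolding adj_def
proof (rule the_equality)
  fix b' :: "'a ell2 \<Rightarrow>\<^sub>L 'a ell2"
  assume "\<forall>f g. cinner (a f) g = cinner f (b' g)"
  then have "Rep_ell2 (b' g) x = Rep_ell2 (b g) x" for g x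
    using assms by (metis cinner_ket)
  then show "b' = b" by (intro blinfun_eqI) (metis Rep_ell2_inject ext)
qed (rule assms)

lemma cinner_adj:
  assumes "clinear_op a"
  shows "cinner (a f) g = cinner f (adj a g)"
proof -
  have cinner_sum_left: "cinner (sum h F) g = (\<Sum>x\<in>F. cinner (h x) g)" for h :: "'a \<Rightarrow> 'a ell2" and F g
    by (induction F rule: infinite_finite_induct)
      (auto simp: cinner_add_left cinner.rep_eq[of 0] zero_ell2.rep_eq)
  have a_lin: "a (\<Sum>x\<in>F. c x *\<^sub>C ket x) = (\<Sum>x\<in>F. c x *\<^sub>C a (ket x))" for c F
    using assms by (simp add: blinfun.sum_right clinear_op_def)
  define w where "w g x = cinner (a (ket x)) g" for g x
  have fin: "(\<Sum>x\<in>F. (cmod (w g x))\<^sup>2) \<le> (norm a * norm g)\<^sup>2" if F: "finite F" for g F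
  proof -
    let ?S = "\<Sum>x\<in>F. (cmod (w g x))\<^sup>2" and ?z = "\<Sum>x\<in>F. w g x *\<^sub>C ket x"
    have "(norm ?z)\<^sup>2 = (\<Sum>\<^sub>\<infinity>x\<in>F. (cmod (w g x))\<^sup>2)"
      unfolding norm_ell2_sq Rep_ell2_truncation[OF F] by (rule infsum_cong_neutral) auto
    then have z: "(norm ?z)\<^sup>2 = ?S" using F by simp
    have "cinner (a ?z) g = of_real ?S"
      unfolding a_lin cinner_sum_left cinner_scaleC_left w_def[symmetric] of_real_sum
      by (rule sum.cong) (simp_all add: complex_norm_square mult.commute flip: of_real_power)
    then have "?S \<le> norm (a ?z) * norm g"
      using cinner_Cauchy_Schwarz[of "a ?z" g] by (simp only: norm_of_real)
    also have "\<dots> \<le> norm ?z * (norm a * norm g)"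
      using mult_right_mono[OF norm_blinfun[of a ?z], of "norm g"] by (simp add: mult_ac)
    finally have "norm ?z * norm ?z \<le> norm ?z * (norm a * norm g)"
      using z by (simp add: power2_eq_square)
    then have "norm ?z \<le> norm a * norm g"
      by (smt (verit) mult_le_cancel_left_pos mult_nonneg_nonneg norm_ge_zero)
    then show ?thesis unfolding z[symmetric] by (intro power_mono) auto
  qed
  have summ: "(\<lambda>x. (cmod (w g x))\<^sup>2) summable_on UNIV" for g
    by (rule nonneg_bdd_above_summable_on) (use fin in \<open>auto intro!: bdd_aboveI2\<close>)
  define B where "B g = Abs_ell2 (w g)" for g
  have B: "Rep_ell2 (B g) = w g" for g
    unfolding B_def using summ by (simp add: Abs_ell2_inverse)
  have B_bound: "norm (B g) \<le> norm g * norm a" for g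
  proof -
    have "(norm (B g))\<^sup>2 \<le> (norm a * norm g)\<^sup>2"
      unfolding norm_ell2_sq B by (rule infsum_le_finite_sums[OF summ]) (use fin in auto)
    then show ?thesis by (simp add: abs_le_square_iff[symmetric] abs_mult mult.commute)
  qed
  have "bounded_linear B"
  proof (rule bounded_linear_intro[OF _ _ B_bound])
    show "B (f + g) = B f + B g" for f g
      by (subst Rep_ell2_inject[symmetric], rule ext)
        (simp add: B plus_ell2.rep_eq w_def cinner_add_right)
    show "B (r *\<^sub>R f) = r *\<^sub>R B f" for r f
      by (subst Rep_ell2_inject[symmetric], rule ext)
        (simp add: B scaleR_ell2_def scaleC.rep_eq w_def cinner_scaleC_right)
  qed
  then have B_apply: "Blinfun B g = B g" for g by (simp add: bounded_linear_Blinfun_apply)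
  have "cinner (a f) g = cinner f (B g)" for f g
  proof (rule ccontr)
    let ?D = "\<lambda>f. cinner (a f) g - cinner f (B g)" and ?K = "norm a * norm g + norm (B g)"
    assume "cinner (a f) g \<noteq> cinner f (B g)"
    then have pos: "0 < cmod (?D f)" by simp
    have D: "cmod (?D f) \<le> norm f * ?K" for f
    proof -
      have "cmod (?D f) \<le> norm (a f) * norm g + norm f * norm (B g)"
        using norm_triangle_ineq4 cinner_Cauchy_Schwarz add_mono by (metis (no_types) order_trans)
      also have "\<dots> \<le> (norm a * norm f) * norm g + norm f * norm (B g)"
        by (simp add: norm_blinfun mult_right_mono)
      finally show ?thesis by (simp add: algebra_simps)
    qed
    have K: "0 < ?K + 1" by (smt (verit) mult_nonneg_nonneg norm_ge_zero)
    obtain F where F: "finite F"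
      "norm (f - (\<Sum>x\<in>F. Rep_ell2 f x *\<^sub>C ket x)) < cmod (?D f) / (?K + 1)"
      using ell2_truncation_approx[of "cmod (?D f) / (?K + 1)" f] pos K by auto
    let ?t = "\<Sum>x\<in>F. Rep_ell2 f x *\<^sub>C ket x"
    have "?D ?t = 0"
      unfolding a_lin cinner_sum_left cinner_scaleC_left by (simp add: cinner_ket B w_def)
    moreover have "?D f = ?D (f - ?t) + ?D ?t"
      using cinner_add_left[of "f - ?t" ?t "B g"] cinner_add_left[of "a (f - ?t)" "a ?t" g]
      by (simp add: blinfun.diff_right)
    ultimately have "cmod (?D f) \<le> norm (f - ?t) * (?K + 1)"
      using D[of "f - ?t"] by (simp add: distrib_left) (smt (verit) norm_ge_zero)
    also have "\<dots> < cmod (?D f)"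
      using F(2) K by (simp add: pos_less_divide_eq)
    finally show False by simp
  qed
  then have "adj a = Blinfun B" by (intro adj_unique) (simp add: B_apply)
  then show ?thesis using \<open>\<And>f g. cinner (a f) g = cinner f (B g)\<close> by (simp add: B_apply)
qed

lemma weighted_shift_summable:
  fixes f :: "'a \<Rightarrow> complex"
  assumes f: "(\<lambda>x. (cmod (f x))\<^sup>2) summable_on UNIV" and inj: "inj_on m {x. P x}"
  shows "(\<lambda>x. (cmod (if P x then f (m x) else 0))\<^sup>2) summable_on UNIV" (is "?g summable_on _")
    and "(\<Sum>\<^sub>\<infinity>x. (cmod (if P x then f (m x) else 0))\<^sup>2) \<le> (\<Sum>\<^sub>\<infinity>x. (cmod (f x))\<^sup>2)"
proof -
  have *: "sum ?g F \<le> (\<Sum>\<^sub>\<infinity>x. (cmod (f x))\<^sup>2)" if "finite F" for F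
  proof -
    have "sum ?g F = sum ?g {x\<in>F. P x}"
      using that by (intro sum.mono_neutral_right) auto
    also have "\<dots> = (\<Sum>y\<in>m ` {x\<in>F. P x}. (cmod (f y))\<^sup>2)"
      by (subst sum.reindex) (use inj in \<open>auto simp: inj_on_def intro!: sum.cong\<close>)
    also have "\<dots> \<le> (\<Sum>\<^sub>\<infinity>x. (cmod (f x))\<^sup>2)"
      using that f by (intro finite_sum_le_infsum) auto
    finally show ?thesis .
  qed
  show s: "?g summable_on UNIV"
    by (rule nonneg_bdd_above_summable_on) (use * in \<open>auto intro!: bdd_aboveI2\<close>)
  show "infsum ?g UNIV \<le> (\<Sum>\<^sub>\<infinity>x. (cmod (f x))\<^sup>2)"
    by (rule infsum_le_finite_sums[OF s]) (use * in auto)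
qed

lift_definition restrict_ell2 :: "'a set \<Rightarrow> 'a ell2 \<Rightarrow> 'a ell2"
  is "\<lambda>L f x. if x \<in> L then f x else 0"
  using weighted_shift_summable(1)[of _ "\<lambda>x. x"] by auto

definition proj_op :: "'a set \<Rightarrow> 'a ell2 \<Rightarrow>\<^sub>L 'a ell2"
  where "proj_op L = Blinfun (restrict_ell2 L)"

lemma proj_op_apply: "proj_op L f = restrict_ell2 L f"
proof -
  have "bounded_linear (restrict_ell2 L)"
  proof (rule bounded_linear_intro[where K = 1])
    fix f g :: "'a ell2" and r
    show "restrict_ell2 L (f + g) = restrict_ell2 L f + restrict_ell2 L g"
      by transfer auto
    show "restrict_ell2 L (r *\<^sub>R f) = r *\<^sub>R restrict_ell2 L f"
      unfolding scaleR_ell2_def by transfer auto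
    have "(norm (restrict_ell2 L f))\<^sup>2 \<le> (norm f)\<^sup>2"
      unfolding norm_ell2_sq restrict_ell2.rep_eq
      using Rep_ell2[of f] by (intro weighted_shift_summable(2)[of _ "\<lambda>x. x"]) auto
    then show "norm (restrict_ell2 L f) \<le> norm f * 1"
      by (simp add: abs_le_square_iff[symmetric])
  qed
  then show ?thesis unfolding proj_op_def by (simp add: bounded_linear_Blinfun_apply)
qed

definition bounded_ops :: "'a set \<Rightarrow> ('a ell2 \<Rightarrow>\<^sub>L 'a ell2) set"
  where "bounded_ops L = {a. clinear_op a \<and> proj_op L o\<^sub>L a = a \<and> a o\<^sub>L proj_op L = a}"

definition compact_ops :: "'a set \<Rightarrow> ('a ell2 \<Rightarrow>\<^sub>L 'a ell2) set"
  where "compact_ops L = {a \<in> bounded_ops L. compact (closure (blinfun_apply a ` cball 0 1))}"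

definition cstar_subalgebra :: "'a set \<Rightarrow> ('a ell2 \<Rightarrow>\<^sub>L 'a ell2) set \<Rightarrow> bool"
  where "cstar_subalgebra L B \<longleftrightarrow> B \<subseteq> bounded_ops L \<and> 0 \<in> B \<and>
    (\<forall>a\<in>B. \<forall>b\<in>B. a + b \<in> B \<and> a o\<^sub>L b \<in> B) \<and> (\<forall>a\<in>B. adj a \<in> B \<and> (\<forall>c. scaleC_op c a \<in> B)) \<and>
    closed B"

definition cstar_generated :: "'a set \<Rightarrow> ('a ell2 \<Rightarrow>\<^sub>L 'a ell2) set \<Rightarrow> ('a ell2 \<Rightarrow>\<^sub>L 'a ell2) set"
  where "cstar_generated L S = \<Inter>{B. cstar_subalgebra L B \<and> S \<subseteq> B}"


section \<open>The algebra of a monomial ideal\<close>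

text \<open>In the coordinates of \<open>\<ell>\<^sup>2\<close>, the operator \<open>T\<^sub>i\<close> with \<open>T\<^sub>i e\<^sub>\<nu> = e\<^bsub>i\<nu>\<^esub>\<close> for \<open>i\<nu> \<in> L\<close> and
  \<open>T\<^sub>i e\<^sub>\<nu> = 0\<close> otherwise.\<close>

lift_definition shift_ell2 :: "nat list set \<Rightarrow> nat \<Rightarrow> nat list ell2 \<Rightarrow> nat list ell2"
  is "\<lambda>L i f w. if w \<in> L \<and> w \<noteq> [] \<and> hd w = i then f (tl w) else 0"
  by (rule weighted_shift_summable(1)) (auto simp: inj_on_def intro: list.expand)

definition shift_op :: "nat list set \<Rightarrow> nat \<Rightarrow> nat list ell2 \<Rightarrow>\<^sub>L nat list ell2"
  where "shift_op L i = Blinfun (shift_ell2 L i)"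

lemma shift_op_apply: "shift_op L i f = shift_ell2 L i f"
proof -
  have "bounded_linear (shift_ell2 L i)"
  proof (rule bounded_linear_intro[where K = 1])
    fix f g :: "nat list ell2" and r
    show "shift_ell2 L i (f + g) = shift_ell2 L i f + shift_ell2 L i g"
      by transfer auto
    show "shift_ell2 L i (r *\<^sub>R f) = r *\<^sub>R shift_ell2 L i f"
      unfolding scaleR_ell2_def by transfer auto
    have "(norm (shift_ell2 L i f))\<^sup>2 \<le> (norm f)\<^sup>2"
      unfolding norm_ell2_sq shift_ell2.rep_eq using Rep_ell2[of f]
      by (intro weighted_shift_summable(2)) (auto simp: inj_on_def intro: list.expand)
    then show "norm (shift_ell2 L i f) \<le> norm f * 1"
      by (simp add: abs_le_square_iff[symmetric])
  qed
  then show ?thesis unfolding shift_op_def by (simp add: bounded_linear_Blinfun_apply)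
qed

lemma shift_op_ket: "shift_op L i (ket \<nu>) = (if i # \<nu> \<in> L then ket (i # \<nu>) else 0)"
proof -
  have "Rep_ell2 (shift_ell2 L i (ket \<nu>)) w
      = Rep_ell2 (if i # \<nu> \<in> L then ket (i # \<nu>) else 0) w" for w
    by (cases w) (auto simp: shift_ell2.rep_eq ket.rep_eq zero_ell2.rep_eq)
  then have "Rep_ell2 (shift_ell2 L i (ket \<nu>)) = Rep_ell2 (if i # \<nu> \<in> L then ket (i # \<nu>) else 0)"
    by (rule ext)
  then show ?thesis unfolding shift_op_apply Rep_ell2_inject .
qed

definition shift_word :: "nat list set \<Rightarrow> nat list \<Rightarrow> nat list ell2 \<Rightarrow>\<^sub>L nat list ell2"
  where "shift_word L \<mu> = foldr (\<lambda>i a. shift_op L i o\<^sub>L a) \<mu> (proj_op L)"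

type_synonym word_op = "nat list ell2 \<Rightarrow>\<^sub>L nat list ell2"

definition cstar_T :: "nat \<Rightarrow> (nat list \<Rightarrow>\<^sub>0 complex) set \<Rightarrow> word_op set"
  where "cstar_T d I = (let L = allowed_words d I in
    cstar_generated L (insert (proj_op L) (shift_op L ` {1..d})))"


section \<open>Star-algebras, quotients and isomorphisms\<close>

record 'b star_algebra = "(complex, 'b) module" +
  star :: "'b \<Rightarrow> 'b"

definition op_star_algebra :: "'a set \<Rightarrow> ('a ell2 \<Rightarrow>\<^sub>L 'a ell2) set \<Rightarrow> ('a ell2 \<Rightarrow>\<^sub>L 'a ell2) star_algebra"
  where "op_star_algebra L B =
    \<lparr>carrier = B, mult = (o\<^sub>L), one = proj_op L, zero = 0, add = (+), smult = scaleC_op, star = adj\<rparr>"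

text \<open>The scalar multiple and the adjoint of a coset are unions of cosets, all of which
  coincide when \<open>K\<close> is a self-adjoint ideal.\<close>

definition quotient_star_algebra :: "'b star_algebra \<Rightarrow> 'b set \<Rightarrow> 'b set star_algebra"
  where "quotient_star_algebra A K =
    \<lparr>carrier = carrier (A Quot K), mult = mult (A Quot K), one = one (A Quot K),
     zero = zero (A Quot K), add = add (A Quot K),
     smult = (\<lambda>c X. \<Union>a\<in>X. K +>\<^bsub>A\<^esub> (c \<odot>\<^bsub>A\<^esub> a)),
     star = (\<lambda>X. \<Union>a\<in>X. K +>\<^bsub>A\<^esub> star A a)\<rparr>"

definition star_isomorphic :: "'b star_algebra \<Rightarrow> 'c star_algebra \<Rightarrow> bool" (infix \<open>\<simeq>\<^sub>*\<close> 50)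
  where "A \<simeq>\<^sub>* B \<longleftrightarrow> (\<exists>h \<in> ring_iso A B. \<forall>a\<in>carrier A.
    h (star A a) = star B (h a) \<and> (\<forall>c. h (c \<odot>\<^bsub>A\<^esub> a) = c \<odot>\<^bsub>B\<^esub> h a))"

definition cstar_T_algebra :: "nat \<Rightarrow> (nat list \<Rightarrow>\<^sub>0 complex) set \<Rightarrow> word_op star_algebra"
  where "cstar_T_algebra d I = op_star_algebra (allowed_words d I) (cstar_T d I)"


section \<open>Quantised dynamics\<close>

definition dyn_algebra :: "nat \<Rightarrow> (nat list \<Rightarrow>\<^sub>0 complex) set \<Rightarrow> word_op set"
  where "dyn_algebra d I = (let L = allowed_words d I in
    cstar_generated L ((\<lambda>\<mu>. adj (shift_word L \<mu>) o\<^sub>L shift_word L \<mu>) ` L))"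

definition dyn_endo :: "nat \<Rightarrow> (nat list \<Rightarrow>\<^sub>0 complex) set \<Rightarrow> nat \<Rightarrow> word_op \<Rightarrow> word_op"
  where "dyn_endo d I i a = (let T = shift_op (allowed_words d I) i in adj T o\<^sub>L a o\<^sub>L T)"

text \<open>Functionals on a set \<open>A\<close> of operators are represented by functions that are
  \<open>undefined\<close> outside \<open>A\<close>.\<close>

definition characters :: "('a ell2 \<Rightarrow>\<^sub>L 'a ell2) set \<Rightarrow> (('a ell2 \<Rightarrow>\<^sub>L 'a ell2) \<Rightarrow> complex) set"
  where "characters A = {\<omega> \<in> extensional A.
    (\<forall>a\<in>A. \<forall>b\<in>A. \<omega> (a + b) = \<omega> a + \<omega> b \<and> \<omega> (a o\<^sub>L b) = \<omega> a * \<omega> b) \<and>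
    (\<forall>a\<in>A. \<forall>c. \<omega> (scaleC_op c a) = c * \<omega> a) \<and> (\<exists>a\<in>A. \<omega> a \<noteq> 0)}"

definition gelfand_spectrum :: "('a ell2 \<Rightarrow>\<^sub>L 'a ell2) set \<Rightarrow> (('a ell2 \<Rightarrow>\<^sub>L 'a ell2) \<Rightarrow> complex) topology"
  where "gelfand_spectrum A = subtopology (product_topology (\<lambda>_. euclidean) A) (characters A)"

definition Omega :: "nat \<Rightarrow> (nat list \<Rightarrow>\<^sub>0 complex) set \<Rightarrow> (word_op \<Rightarrow> complex) topology"
  where "Omega d I = gelfand_spectrum (dyn_algebra d I)"

definition Omega_part :: "nat \<Rightarrow> (nat list \<Rightarrow>\<^sub>0 complex) set \<Rightarrow> nat \<Rightarrow> (word_op \<Rightarrow> complex) set"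
  where "Omega_part d I i = {\<omega> \<in> topspace (Omega d I).
    \<omega> (adj (shift_op (allowed_words d I) i) o\<^sub>L shift_op (allowed_words d I) i) = 1}"

text \<open>The Gelfand transform of \<open>a\<close> at \<open>\<omega>\<close> is \<open>\<omega> a\<close>, so \<open>\<alpha>\<^sub>i(a) = a \<circ> \<phi>\<^sub>i\<close> on \<open>Omega_part d I i\<close>
  says that \<open>\<phi>\<^sub>i \<omega>\<close> is \<open>\<omega> \<circ> \<alpha>\<^sub>i\<close>. Values outside \<open>Omega_part d I i\<close> are irrelevant.\<close>

definition dyn_map ::
    "nat \<Rightarrow> (nat list \<Rightarrow>\<^sub>0 complex) set \<Rightarrow> nat \<Rightarrow> (word_op \<Rightarrow> complex) \<Rightarrow> (word_op \<Rightarrow> complex)"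
  where "dyn_map d I i \<omega> = (\<lambda>a\<in>dyn_algebra d I. \<omega> (dyn_endo d I i a))"

definition Q_set :: "nat \<Rightarrow> (nat list \<Rightarrow>\<^sub>0 complex) set \<Rightarrow> nat set \<Rightarrow> (word_op \<Rightarrow> complex) set"
  where "Q_set d I S = {\<omega> \<in> topspace (Omega d I). \<forall>i\<in>{1..d}. \<omega> \<in> Omega_part d I i \<longleftrightarrow> i \<in> S}"

definition QP_locally_piecewise_conjugate ::
    "nat \<Rightarrow> (nat list \<Rightarrow>\<^sub>0 complex) set \<Rightarrow> nat \<Rightarrow> (nat list \<Rightarrow>\<^sub>0 complex) set \<Rightarrow> bool"
  where "QP_locally_piecewise_conjugate d I d' J \<longleftrightarrow> d = d' \<and>
    (\<exists>\<gamma>. homeomorphic_map (Omega d' J) (Omega d I) \<gamma> \<and>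
      (\<forall>S \<subseteq> {1..d}. \<forall>y \<in> Q_set d' J S.
        \<exists>U \<subseteq> Q_set d' J S. (\<exists>V. openin (Omega d' J) V \<and> y \<in> V \<and> V \<subseteq> U) \<and>
          (\<exists>S' \<subseteq> {1..d}. card S' = card S \<and> \<gamma> ` U \<subseteq> Q_set d I S' \<and>
            (\<exists>\<pi>. bij_betw \<pi> S S' \<and>
              (\<forall>i\<in>S. \<forall>u\<in>U. \<gamma> (dyn_map d' J i u) = dyn_map d I (\<pi> i) (\<gamma> u))))))"

end

theory Submission
  imports Defs
begin

text \<open>The isomorphisms are implemented by a unitary between the two Fock spaces. Let \<open>\<gamma>\<close> be the
  homeomorphism from the spectrum of \<open>\<J>\<close> to the spectrum of \<open>\<I>\<close>, and let \<open>\<omega>\<^sub>\<nu>\<close> denote the vector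
  state at the basis vector \<open>e\<^sub>\<nu>\<close>, restricted to the diagonal algebra.

  A character \<open>\<omega>\<close> is determined by its past, the set of words \<open>\<mu>\<close> with \<open>\<omega>(T\<^sub>\<mu>\<^sup>*T\<^sub>\<mu>) = 1\<close>. Applying \<open>\<phi>\<^sub>i\<close>
  selects the words in the past that end in \<open>i\<close> and deletes this last letter, so piecewise
  conjugacy permutes the branches of these trees of words and preserves the number of words of each
  length (\<open>card_past_level\<close>). Among all characters the vacuum state \<open>\<omega>\<^sub>\<emptyset>\<close> is the one with the largest
  past, the whole language. Counting in both directions shows that \<open>\<gamma>\<close> maps vacuum to vacuum
  (\<open>\<gamma>_vacuum\<close>); this is what makes the conjugacy visible on the Fock spaces.

  The spectrum is compact, and the characters with prescribed past up to length \<open>N\<close> form a basis of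
  clopen sets. By a Lebesgue number argument (\<open>locally_constant_choice\<close>) the local bijections of
  letters can be chosen as functions \<open>\<pi>\<^sub>y\<close> of the past of \<open>y\<close> up to some fixed length. Since \<open>\<omega>\<^bsub>i\<nu>\<^esub>\<close> is
  the image of \<open>\<omega>\<^sub>\<nu>\<close> under the \<open>i\<close>-th map, the rule \<open>\<sigma>(i\<nu>) = \<pi>(i) \<sigma>(\<nu>)\<close> with \<open>\<pi>\<close> chosen at \<open>\<omega>\<^sub>\<nu>\<close>,
  started at the empty word, defines a bijection between the two languages with \<open>\<gamma>(\<omega>\<^sub>\<nu>) = \<omega>\<^bsub>\<sigma>(\<nu>)\<^esub>\<close>
  (\<open>obtains_relabelling\<close>).

  Let \<open>V\<close> be the unitary \<open>e\<^bsub>\<sigma>(\<nu>)\<^esub> \<mapsto> e\<^sub>\<nu>\<close>. Then \<open>V T\<^sub>j V\<^sup>* = \<Sum>\<^sub>i R\<^sub>i p\<^bsub>ij\<^esub>\<close>, where \<open>p\<^bsub>ij\<^esub>\<close> projects onto the words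
  \<open>\<nu>\<close> at which \<open>i\<close> is relabelled to \<open>j\<close>. This depends on finitely many words in the past only, so
  \<open>p\<^bsub>ij\<^esub>\<close> lies in the diagonal algebra. The same holds for the inverse relabelling because \<open>\<gamma>\<close> is
  open. Hence conjugation by \<open>V\<close> maps \<open>C\<^sup>*(T)\<close> onto \<open>C\<^sup>*(R)\<close> (\<open>conj_cstar_T\<close>), and as it maps compact
  operators to compact operators it induces the isomorphism of the quotients
  (\<open>star_isomorphic_by_conjugation\<close>).\<close>

section \<open>Adjoints and C*-subalgebras of operators\<close>

lemma ell2_eqI: "(\<And>x. Rep_ell2 f x = Rep_ell2 g x) \<Longrightarrow> f = g"
  by (metis Rep_ell2_inject ext)

lemma op_eqI: "(\<And>f x. Rep_ell2 (blinfun_apply a f) x = Rep_ell2 (blinfun_apply b f) x) \<Longrightarrow> a = b"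
  by (metis ell2_eqI blinfun_eqI)

lemma Rep_ell2_simps:
  "Rep_ell2 (f + g) x = Rep_ell2 f x + Rep_ell2 g x"
  "Rep_ell2 (f - g) x = Rep_ell2 f x - Rep_ell2 g x"
  "Rep_ell2 (- f) x = - Rep_ell2 f x"
  "Rep_ell2 (c *\<^sub>C f) x = c * Rep_ell2 f x"
  "Rep_ell2 0 x = 0"
  "Rep_ell2 (ket y) x = (if x = y then 1 else 0)"
  unfolding minus_ell2_def plus_ell2.rep_eq uminus_ell2.rep_eq scaleC.rep_eq
    zero_ell2.rep_eq ket.rep_eq by simp_all

lemma cinner_adj2:
  assumes "clinear_op a"
  shows "cinner f (a g) = cinner (adj a f) g"
  by (metis assms cinner_adj cinner_commute)

lemma clinear_op_simps:
  fixes a b :: "'a ell2 \<Rightarrow>\<^sub>L 'a ell2"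
  shows "clinear_op (0 :: 'a ell2 \<Rightarrow>\<^sub>L 'a ell2)"
    and "clinear_op a \<Longrightarrow> clinear_op b \<Longrightarrow> clinear_op (a + b)"
    and "clinear_op a \<Longrightarrow> clinear_op b \<Longrightarrow> clinear_op (a - b)"
    and "clinear_op a \<Longrightarrow> clinear_op b \<Longrightarrow> clinear_op (a o\<^sub>L b)"
    and "clinear_op a \<Longrightarrow> clinear_op (scaleC_op c a)"
  unfolding clinear_op_def
  by (auto simp: blinfun.add_left blinfun.diff_left scaleC_op_apply Rep_ell2_simps algebra_simps
      intro!: ell2_eqI)

lemma clinear_adj:
  assumes "clinear_op a"
  shows "clinear_op (adj a)"
  unfolding clinear_op_def
proof (intro allI)
  fix c f
  have "cinner (ket x) (adj a (c *\<^sub>C f)) = cinner (ket x) (c *\<^sub>C adj a f)" for x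
    by (simp add: assms cinner_scaleC_right flip: cinner_adj)
  then show "adj a (c *\<^sub>C f) = c *\<^sub>C adj a f"
    by (intro ell2_eqI) (simp add: cinner_ket)
qed

lemma adj_adj: "clinear_op a \<Longrightarrow> adj (adj a) = a"
  by (intro adj_unique) (simp add: cinner_adj2)

lemma adj_compose: "clinear_op a \<Longrightarrow> clinear_op b \<Longrightarrow> adj (a o\<^sub>L b) = adj b o\<^sub>L adj a"
  by (intro adj_unique) (simp add: cinner_adj)

lemma adj_add: "clinear_op a \<Longrightarrow> clinear_op b \<Longrightarrow> adj (a + b) = adj a + adj b"
  by (intro adj_unique) (simp add: blinfun.add_left cinner_add_left cinner_add_right cinner_adj)

lemma adj_scaleC: "clinear_op a \<Longrightarrow> adj (scaleC_op c a) = scaleC_op (cnj c) (adj a)"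
  by (intro adj_unique) (simp add: scaleC_op_apply cinner_scaleC_left cinner_scaleC_right cinner_adj)

lemma scaleC_op_simps:
  "scaleC_op c a o\<^sub>L b = scaleC_op c (a o\<^sub>L b)"
  "clinear_op b \<Longrightarrow> b o\<^sub>L scaleC_op c a = scaleC_op c (b o\<^sub>L a)"
  "scaleC_op (of_real r) a = r *\<^sub>R a"
  by (rule op_eqI; simp add: scaleC_op_apply clinear_op_def Rep_ell2_simps blinfun.scaleR_left
      scaleR_ell2_def)+

lemma adj_diff:
  assumes "clinear_op a" "clinear_op b"
  shows "adj (a - b) = adj a - adj b"
  using adj_add[of "a - b" b] assms by (simp add: clinear_op_simps)

lemma norm_adj_le:
  fixes a :: "'a ell2 \<Rightarrow>\<^sub>L 'a ell2"
  assumes "clinear_op a"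
  shows "norm (adj a) \<le> norm a"
proof (rule norm_blinfun_bound)
  fix g
  have "(norm (adj a g))\<^sup>2 = Re (cinner (a (adj a g)) g)"
    by (simp add: cinner_adj assms dot_square_norm flip: inner_ell2_def)
  also have "\<dots> \<le> norm (a (adj a g)) * norm g"
    using cinner_Cauchy_Schwarz complex_Re_le_cmod order_trans by blast
  also have "\<dots> \<le> norm (adj a g) * (norm a * norm g)"
    using mult_right_mono[OF norm_blinfun[of a "adj a g"], of "norm g"] by (simp add: mult_ac)
  finally show "norm (adj a g) \<le> norm a * norm g"
    by (metis mult_le_cancel_left_pos mult_nonneg_nonneg norm_ge_zero order_le_less power2_eq_square)
qed simp

lemma tendsto_adj:
  assumes "X \<longlonglongrightarrow> a" "\<And>n. clinear_op (X n)" "clinear_op a"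
  shows "(\<lambda>n::nat. adj (X n)) \<longlonglongrightarrow> adj a"
proof (rule Lim_null_comparison[THEN LIM_zero_cancel])
  show "\<forall>\<^sub>F n in sequentially. norm (adj (X n) - adj a) \<le> norm (X n - a)"
    using assms by (simp add: clinear_op_simps norm_adj_le flip: adj_diff)
  show "(\<lambda>n. norm (X n - a)) \<longlonglongrightarrow> 0"
    using assms(1) by (simp add: LIM_zero tendsto_norm_zero)
qed

lemma closed_clinear: "closed {a :: 'a ell2 \<Rightarrow>\<^sub>L 'a ell2. clinear_op a}"
proof -
  have "{a :: 'a ell2 \<Rightarrow>\<^sub>L 'a ell2. clinear_op a} =
      (\<Inter>c f x. {a. cinner (ket x) (blinfun_apply a (c *\<^sub>C f)) = c * cinner (ket x) (blinfun_apply a f)})"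
    by (auto simp: clinear_op_def cinner_ket Rep_ell2_simps intro!: ell2_eqI)
  moreover have "bounded_linear (cinner f)" for f :: "'a ell2"
  proof (rule bounded_linear_intro)
    show "norm (cinner f g) \<le> norm g * norm f" for g
      using cinner_Cauchy_Schwarz[of f g] by (simp add: mult.commute)
  qed (simp_all add: cinner_add_right scaleR_ell2_def cinner_scaleC_right scaleR_conv_of_real)
  then have "continuous_on UNIV (\<lambda>a. cinner f (blinfun_apply a g))" for f g :: "'a ell2"
    using linear_continuous_on[OF bounded_linear_compose[OF _ blinfun.bounded_linear_left]] by blast
  then have "closed {a :: 'a ell2 \<Rightarrow>\<^sub>L 'a ell2. cinner (ket x) (a (c *\<^sub>C f)) = c * cinner (ket x) (a f)}" for c f x
    by (intro closed_Collect_eq continuous_on_mult_left) auto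
  ultimately show ?thesis by (auto intro!: closed_INT)
qed

lemma proj_op_Rep: "Rep_ell2 (proj_op E f) x = (if x \<in> E then Rep_ell2 f x else 0)"
  by (simp add: proj_op_apply restrict_ell2.rep_eq)

lemma proj_op_compose: "proj_op E o\<^sub>L proj_op F = proj_op (E \<inter> F)"
  by (rule op_eqI) (simp add: proj_op_Rep)

lemma clinear_proj: "clinear_op (proj_op E)"
  by (auto simp: clinear_op_def proj_op_Rep Rep_ell2_simps intro!: ell2_eqI)

lemma adj_proj: "adj (proj_op E) = proj_op E"
proof (rule adj_unique, intro allI)
  show "cinner (proj_op E f) g = cinner f (proj_op E g)" for f g
    unfolding cinner.rep_eq by (rule infsum_cong) (simp add: proj_op_Rep)
qed

lemma bounded_ops_clinear: "a \<in> bounded_ops L \<Longrightarrow> clinear_op a"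
  by (simp add: bounded_ops_def)

lemma proj_bounded_ops: "E \<subseteq> L \<Longrightarrow> proj_op E \<in> bounded_ops L"
  by (simp add: bounded_ops_def clinear_proj proj_op_compose Int_absorb1 Int_absorb2)

lemma comp_assoc: "(a o\<^sub>L b) o\<^sub>L c = a o\<^sub>L (b o\<^sub>L c)"
  by (rule blinfun_eqI) simp

lemma comp_distrib:
  "(a + b) o\<^sub>L c = (a o\<^sub>L c) + (b o\<^sub>L c)" "a o\<^sub>L (b + c) = (a o\<^sub>L b) + (a o\<^sub>L c)"
  "(0 :: 'a::real_normed_vector \<Rightarrow>\<^sub>L 'b::real_normed_vector) o\<^sub>L d = 0" "a o\<^sub>L 0 = 0"
  "(a - b) o\<^sub>L c = (a o\<^sub>L c) - (b o\<^sub>L c)" "a o\<^sub>L (b - c) = (a o\<^sub>L b) - (a o\<^sub>L c)"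
  by (rule blinfun_eqI; simp add: blinfun.add_left blinfun.add_right blinfun.diff_left blinfun.diff_right)+

lemma cstar_subalgebra_bounded_ops: "cstar_subalgebra L (bounded_ops L)"
  unfolding cstar_subalgebra_def
proof (intro conjI ballI allI)
  show "0 \<in> bounded_ops L"
    by (auto simp: bounded_ops_def clinear_op_simps comp_distrib)
  fix a assume a: "a \<in> bounded_ops L"
  then have [simp]: "proj_op L o\<^sub>L a = a" "a o\<^sub>L proj_op L = a" "clinear_op a"
    by (auto simp: bounded_ops_def)
  then have "proj_op L o\<^sub>L adj a = adj a" "adj a o\<^sub>L proj_op L = adj a"
    by (metis adj_compose adj_proj clinear_proj)+
  then show "adj a \<in> bounded_ops L"
    by (auto simp: bounded_ops_def clinear_adj)
  show "scaleC_op c a \<in> bounded_ops L" for c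
    by (simp add: bounded_ops_def clinear_op_simps scaleC_op_simps clinear_proj)
  show "a + b \<in> bounded_ops L" "a o\<^sub>L b \<in> bounded_ops L" if "b \<in> bounded_ops L" for b
  proof -
    have [simp]: "proj_op L o\<^sub>L b = b" "b o\<^sub>L proj_op L = b" "clinear_op b"
      using that by (auto simp: bounded_ops_def)
    have "proj_op L o\<^sub>L (a o\<^sub>L b) = a o\<^sub>L b"
      by (simp flip: comp_assoc)
    show "a + b \<in> bounded_ops L"
      by (auto simp: bounded_ops_def clinear_op_simps comp_distrib)
    show "a o\<^sub>L b \<in> bounded_ops L"
      using \<open>proj_op L o\<^sub>L (a o\<^sub>L b) = a o\<^sub>L b\<close>
      by (simp add: bounded_ops_def clinear_op_simps comp_assoc)
  qed
next
  have "bounded_ops L = {a. clinear_op a} \<inter> ({a. proj_op L o\<^sub>L a = a} \<inter> {a. a o\<^sub>L proj_op L = a})"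
    by (auto simp: bounded_ops_def)
  moreover have "closed {a. proj_op L o\<^sub>L a = a}" "closed {a. a o\<^sub>L proj_op L = a}"
    by (intro closed_Collect_eq continuous_intros)+
  ultimately show "closed (bounded_ops L)"
    by (simp only:) (intro closed_Int closed_clinear)
qed simp

lemma cstar_subalgebraD:
  assumes "cstar_subalgebra L B"
  shows "B \<subseteq> bounded_ops L" "0 \<in> B" "a \<in> B \<Longrightarrow> b \<in> B \<Longrightarrow> a + b \<in> B"
    "a \<in> B \<Longrightarrow> b \<in> B \<Longrightarrow> a o\<^sub>L b \<in> B" "a \<in> B \<Longrightarrow> adj a \<in> B" "a \<in> B \<Longrightarrow> scaleC_op c a \<in> B" "closed B"
    "a \<in> B \<Longrightarrow> clinear_op a"
  using assms unfolding cstar_subalgebra_def by (auto simp: bounded_ops_def)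

lemma cstar_subalgebra_diff:
  assumes "cstar_subalgebra L B" "a \<in> B" "b \<in> B"
  shows "a - b \<in> B"
proof -
  have "scaleC_op (- 1) b = - b"
    using scaleC_op_simps(3)[of "-1" b] by simp
  then show ?thesis
    using cstar_subalgebraD(3)[OF assms(1,2), of "- b"] cstar_subalgebraD(6)[OF assms(1,3), of "- 1"]
    by simp
qed

lemma cstar_generated_subalgebra:
  assumes "S \<subseteq> bounded_ops L"
  shows "cstar_subalgebra L (cstar_generated L S)"
proof -
  have "bounded_ops L \<in> {B. cstar_subalgebra L B \<and> S \<subseteq> B}"
    using assms cstar_subalgebra_bounded_ops by blast
  moreover have "closed (\<Inter>{B. cstar_subalgebra L B \<and> S \<subseteq> B})"
    by (rule closed_Inter) (simp add: cstar_subalgebra_def)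
  ultimately show ?thesis
    unfolding cstar_generated_def cstar_subalgebra_def[of _ "\<Inter>_"]
    by (auto simp: cstar_subalgebraD)
qed

lemma cstar_generated_incl: "S \<subseteq> cstar_generated L S"
  by (auto simp: cstar_generated_def)

lemma cstar_generated_least: "cstar_subalgebra L B \<Longrightarrow> S \<subseteq> B \<Longrightarrow> cstar_generated L S \<subseteq> B"
  by (auto simp: cstar_generated_def)

text \<open>All statements about elements of a generated C*-algebra below are proved with this rule; the
  subsets of the algebra on which a stable property holds are again C*-subalgebras.\<close>

lemma cstar_generated_induct [consumes 2, case_names gen zero add comp adj scale closed]:
  assumes "a \<in> cstar_generated L S" "S \<subseteq> bounded_ops L"
    and "\<And>a. a \<in> S \<Longrightarrow> P a"
    and "P 0"
    and "\<And>a b. a \<in> cstar_generated L S \<Longrightarrow> b \<in> cstar_generated L S \<Longrightarrow> P a \<Longrightarrow> P b \<Longrightarrow> P (a + b)"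
    and "\<And>a b. a \<in> cstar_generated L S \<Longrightarrow> b \<in> cstar_generated L S \<Longrightarrow> P a \<Longrightarrow> P b \<Longrightarrow> P (a o\<^sub>L b)"
    and "\<And>a. a \<in> cstar_generated L S \<Longrightarrow> P a \<Longrightarrow> P (adj a)"
    and "\<And>a c. a \<in> cstar_generated L S \<Longrightarrow> P a \<Longrightarrow> P (scaleC_op c a)"
    and "\<And>X a. (\<And>n::nat. X n \<in> cstar_generated L S) \<Longrightarrow> (\<And>n. P (X n)) \<Longrightarrow> X \<longlonglongrightarrow> a
      \<Longrightarrow> a \<in> cstar_generated L S \<Longrightarrow> P a"
  shows "P a"
proof -
  let ?B = "cstar_generated L S"
  note B = cstar_subalgebraD[OF cstar_generated_subalgebra[OF assms(2)]]
  have "closed {a \<in> ?B. P a}"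
    unfolding closed_sequential_limits
    using B(7)[unfolded closed_sequential_limits] assms(9) by blast
  then have "cstar_subalgebra L {a \<in> ?B. P a}"
    unfolding cstar_subalgebra_def using B assms(4-8) by auto
  then have "?B \<subseteq> {a \<in> ?B. P a}"
    using assms(3) cstar_generated_incl by (intro cstar_generated_least) auto
  then show ?thesis using assms(1) by blast
qed

section \<open>Composition with partial injections\<close>

text \<open>All concrete operators below (the shifts \<open>T\<^sub>\<mu>\<close>, the projections, and the unitary that
  implements the isomorphism) are compositions with a partially defined injection \<open>m\<close> on the index
  set. The injectivity test only serves to make the definition total.\<close>

lift_definition pull_ell2 :: "'a set \<Rightarrow> ('a \<Rightarrow> 'a) \<Rightarrow> 'a ell2 \<Rightarrow> 'a ell2"
  is "\<lambda>D m f x. if x \<in> D \<and> inj_on m D then f (m x) else 0"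
  by (rule weighted_shift_summable(1)) (auto simp: inj_on_def)

definition pull_op :: "'a set \<Rightarrow> ('a \<Rightarrow> 'a) \<Rightarrow> 'a ell2 \<Rightarrow>\<^sub>L 'a ell2"
  where "pull_op D m = Blinfun (pull_ell2 D m)"

lemma norm_pull_ell2_le: "norm (pull_ell2 D m f) \<le> norm f"
proof -
  have "(norm (pull_ell2 D m f))\<^sup>2 \<le> (norm f)\<^sup>2"
    unfolding norm_ell2_sq pull_ell2.rep_eq
    using Rep_ell2[of f] by (intro weighted_shift_summable(2)) (auto simp: inj_on_def)
  then show ?thesis by (simp add: abs_le_square_iff[symmetric])
qed

lemma pull_op_apply: "pull_op D m f = pull_ell2 D m f"
proof -
  have "bounded_linear (pull_ell2 D m)"
  proof (rule bounded_linear_intro[where K = 1])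
    show "pull_ell2 D m (f + g) = pull_ell2 D m f + pull_ell2 D m g" for f g
      by (rule ell2_eqI) (simp add: pull_ell2.rep_eq Rep_ell2_simps)
    show "pull_ell2 D m (r *\<^sub>R f) = r *\<^sub>R pull_ell2 D m f" for r f
      by (rule ell2_eqI) (simp add: pull_ell2.rep_eq Rep_ell2_simps scaleR_ell2_def)
  qed (simp add: norm_pull_ell2_le)
  then show ?thesis unfolding pull_op_def by (simp add: bounded_linear_Blinfun_apply)
qed

lemma norm_pull_op_le: "norm (pull_op D m f) \<le> norm f"
  by (simp add: pull_op_apply norm_pull_ell2_le)

lemma pull_op_Rep:
  "inj_on m D \<Longrightarrow> Rep_ell2 (pull_op D m f) x = (if x \<in> D then Rep_ell2 f (m x) else 0)"
  by (simp add: pull_op_apply pull_ell2.rep_eq)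

lemma clinear_pull: "clinear_op (pull_op D m)"
  unfolding clinear_op_def
  by (auto simp: pull_op_apply pull_ell2.rep_eq Rep_ell2_simps intro!: ell2_eqI)

lemma adj_pull_op:
  assumes inj: "inj_on m D"
  shows "adj (pull_op D m) = pull_op (m ` D) (inv_into D m)"
proof (rule adj_unique, intro allI)
  fix f g :: "'a ell2"
  let ?n = "inv_into D m"
  have n: "inj_on ?n (m ` D)" by (simp add: inj_on_inv_into)
  have "cinner (pull_op D m f) g = (\<Sum>\<^sub>\<infinity>x\<in>D. cnj (Rep_ell2 f (m x)) * Rep_ell2 g x)"
    unfolding cinner.rep_eq by (rule infsum_cong_neutral) (auto simp: pull_op_Rep inj)
  also have "\<dots> = (\<Sum>\<^sub>\<infinity>x\<in>D. (\<lambda>y. cnj (Rep_ell2 f y) * Rep_ell2 g (?n y)) (m x))"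
    by (rule infsum_cong) (simp add: inj)
  also have "\<dots> = (\<Sum>\<^sub>\<infinity>y\<in>m ` D. cnj (Rep_ell2 f y) * Rep_ell2 g (?n y))"
    by (subst infsum_reindex[OF inj]) (simp only: o_def)
  also have "\<dots> = cinner f (pull_op (m ` D) ?n g)"
    unfolding cinner.rep_eq by (rule infsum_cong_neutral) (auto simp: pull_op_Rep n)
  finally show "cinner (pull_op D m f) g = cinner f (pull_op (m ` D) ?n g)" .
qed

lemma adj_pull_op_Rep:
  assumes "inj_on m D"
  shows "x \<in> D \<Longrightarrow> Rep_ell2 (adj (pull_op D m) f) (m x) = Rep_ell2 f x"
    and "y \<notin> m ` D \<Longrightarrow> Rep_ell2 (adj (pull_op D m) f) y = 0"
  using assms by (auto simp: adj_pull_op pull_op_Rep inj_on_inv_into)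

lemma pull_conj_proj:
  assumes "inj_on m D"
  shows "adj (pull_op D m) o\<^sub>L proj_op E o\<^sub>L pull_op D m = proj_op (m ` (D \<inter> E))"
proof (rule op_eqI)
  fix f y
  show "Rep_ell2 ((adj (pull_op D m) o\<^sub>L proj_op E o\<^sub>L pull_op D m) f) y
      = Rep_ell2 (proj_op (m ` (D \<inter> E)) f) y"
  proof (cases "y \<in> m ` D")
    case True
    then obtain x where "x \<in> D" "y = m x" by blast
    moreover then have "y \<in> m ` (D \<inter> E) \<longleftrightarrow> x \<in> E" using assms by (auto dest: inj_onD)
    ultimately show ?thesis using assms by (simp add: adj_pull_op_Rep proj_op_Rep pull_op_Rep)
  qed (use assms in \<open>auto simp: adj_pull_op_Rep proj_op_Rep\<close>)
qed

lemma adj_pull_pull: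
  assumes "inj_on m D"
  shows "adj (pull_op D m) o\<^sub>L pull_op D m = proj_op (m ` D)"
proof -
  have "proj_op D o\<^sub>L pull_op D m = pull_op D m"
    by (rule op_eqI) (simp add: assms proj_op_Rep pull_op_Rep)
  then show ?thesis
    using pull_conj_proj[OF assms, of D] by (simp add: comp_assoc)
qed

lemma pull_adj_pull:
  assumes "inj_on m D"
  shows "pull_op D m o\<^sub>L adj (pull_op D m) = proj_op D"
  by (rule op_eqI) (use assms in \<open>simp add: pull_op_Rep adj_pull_op_Rep proj_op_Rep\<close>)

lemma shift_op_Rep:
  "Rep_ell2 (shift_op L i f) w = (if w \<in> L \<and> w \<noteq> [] \<and> hd w = i then Rep_ell2 f (tl w) else 0)"
  by (simp add: shift_op_apply shift_ell2.rep_eq)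

lemma inj_on_tl: "inj_on tl {w \<in> L. w \<noteq> [] \<and> hd w = i}"
  by (auto simp: inj_on_def intro: list.expand)

lemma shift_op_pull: "shift_op L i = pull_op {w \<in> L. w \<noteq> [] \<and> hd w = i} tl"
  by (rule op_eqI) (simp add: shift_op_Rep pull_op_Rep inj_on_tl)

lemma tl_image: "tl ` ({w \<in> L. w \<noteq> [] \<and> hd w = i} \<inter> E) = {v. i # v \<in> L \<and> i # v \<in> E}"
  by (force simp: image_iff neq_Nil_conv)

lemma shift_conj_proj:
  "adj (shift_op L i) o\<^sub>L proj_op E o\<^sub>L shift_op L i = proj_op {v. i # v \<in> L \<and> i # v \<in> E}"
  unfolding shift_op_pull by (simp only: pull_conj_proj inj_on_tl tl_image)

section \<open>The language of a monomial ideal\<close>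

lemma monomial_ideal_ideal:
  assumes "monomial_ideal d I"
  shows "ideal I (free_algebra d)"
proof -
  obtain G where G: "G \<subseteq> words d" "I = Idl\<^bsub>free_algebra d\<^esub> (monomial ` G)"
    using assms unfolding monomial_ideal_def by blast
  have "monomial ` G \<subseteq> carrier (free_algebra d)"
    using G(1) by (auto simp: free_algebra_def monomial_def)
  then show ?thesis
    using ring.genideal_ideal[OF ring_free_algebra] G(2) by blast
qed

text \<open>The unit lies outside the ideal because the polynomials without constant term form an ideal
  that contains all generators.\<close>

lemma Nil_in_allowed_words:
  assumes "monomial_ideal d I"
  shows "[] \<in> allowed_words d I"
proof -
  interpret R: ring "free_algebra d" by (rule ring_free_algebra)
  obtain G where G: "G \<subseteq> words d" "\<forall>\<mu>\<in>G. 2 \<le> length \<mu>" "I = Idl\<^bsub>free_algebra d\<^esub> (monomial ` G)"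
    using assms unfolding monomial_ideal_def by blast
  let ?N = "{f \<in> carrier (free_algebra d). [] \<notin> Poly_Mapping.keys f}"
  have keys_mult_Nil: "[] \<in> Poly_Mapping.keys f \<and> [] \<in> Poly_Mapping.keys g"
    if "[] \<in> Poly_Mapping.keys (f * g)" for f g :: "nat list \<Rightarrow>\<^sub>0 complex"
    using keys_mult[of f g] that by (auto simp: plus_list_def)
  have "ideal ?N (free_algebra d)"
  proof (rule idealI[OF ring_free_algebra])
    show "subgroup ?N (add_monoid (free_algebra d))"
    proof (rule group.subgroupI[OF R.add.is_group])
      show "?N \<noteq> {}"
        by (auto simp: free_algebra_def intro!: exI[of _ 0])
      fix f assume f: "f \<in> ?N"
      then have "\<ominus>\<^bsub>free_algebra d\<^esub> f = - f"
        by (intro R.minus_equality) (auto simp: free_algebra_def)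
      then show "inv\<^bsub>add_monoid (free_algebra d)\<^esub> f \<in> ?N"
        using f by (auto simp: free_algebra_def a_inv_def)
      fix g assume g: "g \<in> ?N"
      have "[] \<notin> Poly_Mapping.keys (f + g)"
        using f g Poly_Mapping.keys_add[of f g] by auto
      then show "f \<otimes>\<^bsub>add_monoid (free_algebra d)\<^esub> g \<in> ?N"
        using f g R.a_closed[of f g] by (auto simp: free_algebra_def)
    qed auto
    fix f g assume fg: "f \<in> ?N" "g \<in> carrier (free_algebra d)"
    have "[] \<notin> Poly_Mapping.keys (g * f)" "[] \<notin> Poly_Mapping.keys (f * g)"
      using fg keys_mult_Nil by blast+
    then show "g \<otimes>\<^bsub>free_algebra d\<^esub> f \<in> ?N" "f \<otimes>\<^bsub>free_algebra d\<^esub> g \<in> ?N"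
      using fg R.m_closed[of f g] R.m_closed[of g f] by (simp_all add: free_algebra_def)
  qed
  moreover have "monomial ` G \<subseteq> ?N"
    using G(1,2) by (auto simp: free_algebra_def monomial_def)
  ultimately have "I \<subseteq> ?N"
    unfolding G(3) by (rule R.genideal_minimal)
  then show ?thesis
    by (auto simp: allowed_words_def words_def monomial_def)
qed

lemma monomial_carrier: "\<mu> \<in> words d \<Longrightarrow> monomial \<mu> \<in> carrier (free_algebra d)"
  by (simp add: free_algebra_def monomial_def)

lemma allowed_words_factor:
  assumes "monomial_ideal d I" "u @ v \<in> allowed_words d I"
  shows "u \<in> allowed_words d I" "v \<in> allowed_words d I"
proof -
  interpret ideal I "free_algebra d" by (rule monomial_ideal_ideal[OF assms(1)])
  have uv: "u \<in> words d" "v \<in> words d" "monomial u * monomial v \<notin> I"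
    using assms(2) by (auto simp: allowed_words_def words_def monomial_append)
  have m: "a \<otimes>\<^bsub>free_algebra d\<^esub> b = a * b" for a b
    by (simp add: free_algebra_def)
  show "u \<in> allowed_words d I"
    using I_r_closed[OF _ monomial_carrier[OF uv(2)], of "monomial u"] uv m
    by (auto simp: allowed_words_def)
  show "v \<in> allowed_words d I"
    using I_l_closed[OF _ monomial_carrier[OF uv(1)], of "monomial v"] uv m
    by (auto simp: allowed_words_def)
qed

section \<open>The diagonal algebra and its endomorphisms\<close>

definition left_quot :: "nat list set \<Rightarrow> nat list \<Rightarrow> nat list set"
  where "left_quot L \<mu> = {\<nu>. \<mu> @ \<nu> \<in> L}"

locale quantised_dynamics =
  fixes d :: nat and I :: "(nat list \<Rightarrow>\<^sub>0 complex) set"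
  assumes ideal: "monomial_ideal d I"
begin

abbreviation "L \<equiv> allowed_words d I"
abbreviation "A \<equiv> dyn_algebra d I"
abbreviation "\<Omega> \<equiv> characters A"
abbreviation "p \<mu> \<equiv> proj_op (left_quot L \<mu>)"
abbreviation "\<alpha> \<equiv> dyn_endo d I"

lemma Nil_L: "[] \<in> L"
  using ideal by (rule Nil_in_allowed_words)

lemma L_appendD: "u @ v \<in> L \<Longrightarrow> u \<in> L" "u @ v \<in> L \<Longrightarrow> v \<in> L"
  using allowed_words_factor[OF ideal] by blast+

lemma L_ConsD: "i # v \<in> L \<Longrightarrow> v \<in> L"
  using L_appendD(2)[of "[i]" v] by simp

lemma L_letters: "w \<in> L \<Longrightarrow> set w \<subseteq> {1..d}"
  by (auto simp: allowed_words_def words_def)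

lemma finite_L: "finite {w \<in> L. length w \<le> n}"
  by (rule finite_subset[OF _ finite_lists_length_le[of "{1..d}" n]]) (use L_letters in auto)

lemma left_quot_subset: "left_quot L \<mu> \<subseteq> L"
  by (auto simp: left_quot_def dest: L_appendD)

lemma left_quot_empty: "\<mu> \<notin> L \<Longrightarrow> left_quot L \<mu> = {}"
  by (auto simp: left_quot_def dest: L_appendD)

lemma shift_word_Rep:
  "Rep_ell2 (shift_word L \<mu> f) w
    = (if w \<in> L \<and> (\<exists>v. w = \<mu> @ v) then Rep_ell2 f (drop (length \<mu>) w) else 0)"
proof (induction \<mu> arbitrary: w)
  case Nil
  then show ?case by (simp add: shift_word_def proj_op_Rep)
next
  case (Cons i \<mu>)
  have "Rep_ell2 (shift_word L (i # \<mu>) f) w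
      = (if w \<in> L \<and> w \<noteq> [] \<and> hd w = i then Rep_ell2 (shift_word L \<mu> f) (tl w) else 0)"
    by (simp add: shift_word_def shift_op_Rep)
  then show ?case
    by (cases w) (auto simp: Cons.IH dest: L_ConsD)
qed

lemma shift_word_pull:
  "shift_word L \<mu> = pull_op {w \<in> L. \<exists>v. w = \<mu> @ v} (drop (length \<mu>))"
  by (rule op_eqI) (subst pull_op_Rep, auto simp: shift_word_Rep inj_on_def)

lemma shift_word_proj: "adj (shift_word L \<mu>) o\<^sub>L shift_word L \<mu> = p \<mu>"
proof -
  have "inj_on (drop (length \<mu>)) {w \<in> L. \<exists>v. w = \<mu> @ v}"
    by (auto simp: inj_on_def)
  moreover have "drop (length \<mu>) ` {w \<in> L. \<exists>v. w = \<mu> @ v} = left_quot L \<mu>"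
    by (force simp: left_quot_def image_iff)
  ultimately show ?thesis
    unfolding shift_word_pull by (simp add: adj_pull_pull)
qed

lemma A_eq: "A = cstar_generated L (p ` L)"
  by (simp add: dyn_algebra_def shift_word_proj Let_def)

lemma A_gens_bounded: "p ` L \<subseteq> bounded_ops L"
  using left_quot_subset proj_bounded_ops by blast

lemma A_subalgebra: "cstar_subalgebra L A"
  unfolding A_eq by (rule cstar_generated_subalgebra[OF A_gens_bounded])

lemmas A_closed = cstar_subalgebraD(2-6)[OF A_subalgebra] cstar_subalgebra_diff[OF A_subalgebra]

lemma A_clinear: "a \<in> A \<Longrightarrow> clinear_op a"
  using cstar_subalgebraD(8)[OF A_subalgebra] .

lemmas A_induct [consumes 1, case_names gen zero add comp adj scale closed] =
  cstar_generated_induct[OF _ A_gens_bounded, folded A_eq]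

lemma proj_empty: "proj_op {} = 0"
  by (rule op_eqI) (simp add: proj_op_Rep Rep_ell2_simps)

lemma p_in_A: "p \<mu> \<in> A"
proof (cases "\<mu> \<in> L")
  case True
  then show ?thesis unfolding A_eq by (auto intro: subsetD[OF cstar_generated_incl])
qed (simp add: left_quot_empty proj_empty A_closed)

lemma p_Nil: "p [] = proj_op L"
  by (simp add: left_quot_def)

lemma one_in_A: "proj_op L \<in> A"
  using p_in_A[of "[]"] by (simp add: p_Nil)

lemma A_one_left: "a \<in> A \<Longrightarrow> proj_op L o\<^sub>L a = a"
  using cstar_subalgebraD(1)[OF A_subalgebra] by (auto simp: bounded_ops_def)

text \<open>Diagonality of \<open>A\<close>, expressed by commutation with all coordinate projections, is what makes the
  maps \<open>\<alpha>\<^sub>i\<close> and the vector states multiplicative.\<close>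

lemma A_commute: "a \<in> A \<Longrightarrow> a o\<^sub>L proj_op E = proj_op E o\<^sub>L a"
proof (induction rule: A_induct)
  case (gen a)
  then show ?case by (auto simp: proj_op_compose Int_commute)
next
  case (comp a b)
  then show ?case by (metis comp_assoc)
next
  case (adj a)
  then show ?case by (metis A_clinear adj_compose adj_proj clinear_proj)
next
  case (closed X a)
  have "(\<lambda>n. X n o\<^sub>L proj_op E) \<longlonglongrightarrow> (a o\<^sub>L proj_op E)"
    "(\<lambda>n. proj_op E o\<^sub>L X n) \<longlonglongrightarrow> (proj_op E o\<^sub>L a)"
    by (intro bounded_bilinear.tendsto[OF bounded_bilinear_blinfun_compose] closed.hyps tendsto_const)+
  then show ?case unfolding closed.IH by (rule LIMSEQ_unique)
qed (simp_all add: comp_distrib scaleC_op_simps clinear_proj)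

lemma \<alpha>_eq: "\<alpha> i a = adj (shift_op L i) o\<^sub>L a o\<^sub>L shift_op L i"
  by (simp add: dyn_endo_def Let_def)

lemma clinear_shift: "clinear_op (shift_op L i)"
  by (simp add: shift_op_pull clinear_pull)

lemma \<alpha>_proj: "\<alpha> i (proj_op E) = proj_op {v. i # v \<in> L \<and> i # v \<in> E}"
  by (simp add: \<alpha>_eq shift_conj_proj)

lemma \<alpha>_p: "\<alpha> i (p \<mu>) = p (\<mu> @ [i])"
proof -
  have "{v. i # v \<in> L \<and> i # v \<in> left_quot L \<mu>} = left_quot L (\<mu> @ [i])"
    by (auto simp: left_quot_def dest: L_appendD)
  then show ?thesis by (simp add: \<alpha>_proj)
qed

lemma \<alpha>_one: "\<alpha> i (proj_op L) = p [i]"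
  using \<alpha>_p[of i "[]"] by (simp add: p_Nil)

lemma shift_initial_proj: "adj (shift_op L i) o\<^sub>L shift_op L i = p [i]"
proof -
  have "proj_op L o\<^sub>L shift_op L i = shift_op L i"
    by (rule op_eqI) (simp add: proj_op_Rep shift_op_Rep)
  then show ?thesis using \<alpha>_one[of i] by (simp add: \<alpha>_eq comp_assoc)
qed

lemma \<alpha>_add: "\<alpha> i (a + b) = \<alpha> i a + \<alpha> i b"
  by (simp add: \<alpha>_eq comp_distrib)

lemma \<alpha>_scale: "\<alpha> i (scaleC_op c a) = scaleC_op c (\<alpha> i a)"
  by (simp add: \<alpha>_eq scaleC_op_simps clinear_adj clinear_shift)

text \<open>Multiplicativity comes from diagonality: \<open>T\<^sub>iT\<^sub>i\<^sup>*\<close> is a diagonal projection, so it commutes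
  with \<open>b\<close> and is then absorbed by \<open>T\<^sub>i\<close>.\<close>

lemma \<alpha>_comp:
  assumes "b \<in> A"
  shows "\<alpha> i (a o\<^sub>L b) = \<alpha> i a o\<^sub>L \<alpha> i b"
proof -
  let ?T = "shift_op L i" and ?E = "{w \<in> L. w \<noteq> [] \<and> hd w = i}"
  have TT: "?T o\<^sub>L adj ?T = proj_op ?E"
    by (simp add: shift_op_pull pull_adj_pull inj_on_tl)
  have ET: "proj_op ?E o\<^sub>L ?T = ?T"
    by (rule op_eqI) (auto simp: proj_op_Rep shift_op_Rep)
  have "\<alpha> i a o\<^sub>L \<alpha> i b = adj ?T o\<^sub>L a o\<^sub>L (?T o\<^sub>L adj ?T) o\<^sub>L b o\<^sub>L ?T"
    by (simp add: \<alpha>_eq comp_assoc)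
  also have "\<dots> = adj ?T o\<^sub>L a o\<^sub>L (b o\<^sub>L proj_op ?E) o\<^sub>L ?T"
    unfolding TT A_commute[OF assms] by (simp add: comp_assoc)
  also have "\<dots> = adj ?T o\<^sub>L a o\<^sub>L b o\<^sub>L ?T"
    by (simp add: comp_assoc ET)
  finally show ?thesis by (simp add: \<alpha>_eq comp_assoc)
qed

lemma \<alpha>_in_A: "a \<in> A \<Longrightarrow> \<alpha> i a \<in> A"
proof (induction rule: A_induct)
  case (gen a)
  then show ?case using \<alpha>_p p_in_A by auto
next
  case zero
  then show ?case by (simp add: \<alpha>_eq comp_distrib A_closed)
next
  case (adj a)
  then have "\<alpha> i (adj a) = adj (\<alpha> i a)"
    by (simp add: \<alpha>_eq adj_compose clinear_op_simps clinear_adj clinear_shift A_clinear adj_adj comp_assoc)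
  then show ?case using adj by (simp add: A_closed)
next
  case (closed X a)
  have "(\<lambda>n. \<alpha> i (X n)) \<longlonglongrightarrow> \<alpha> i a"
    unfolding \<alpha>_eq by (intro bounded_bilinear.tendsto[OF bounded_bilinear_blinfun_compose] closed.hyps tendsto_const)
  then show ?case
    by (rule closed_sequentially[OF cstar_subalgebraD(7)[OF A_subalgebra] closed.IH])
qed (simp_all add: \<alpha>_add \<alpha>_scale \<alpha>_comp A_closed)


section \<open>Characters\<close>

lemma charD:
  assumes "\<omega> \<in> \<Omega>"
  shows "a \<in> A \<Longrightarrow> b \<in> A \<Longrightarrow> \<omega> (a + b) = \<omega> a + \<omega> b"
    and "a \<in> A \<Longrightarrow> b \<in> A \<Longrightarrow> \<omega> (a o\<^sub>L b) = \<omega> a * \<omega> b"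
    and "a \<in> A \<Longrightarrow> \<omega> (scaleC_op c a) = c * \<omega> a"
    and "\<exists>a\<in>A. \<omega> a \<noteq> 0"
    and "\<omega> \<in> extensional A"
  using assms by (auto simp: characters_def)

lemma char_zero: "\<omega> \<in> \<Omega> \<Longrightarrow> \<omega> 0 = 0"
  using charD(1)[of \<omega> 0 0] A_closed(1) by simp

lemma char_one: "\<omega> \<in> \<Omega> \<Longrightarrow> \<omega> (proj_op L) = 1"
  using charD(2)[of \<omega> "proj_op L"] charD(4)[of \<omega>] one_in_A A_one_left by fastforce

lemma char_diff:
  assumes "\<omega> \<in> \<Omega>" "a \<in> A" "b \<in> A"
  shows "\<omega> (a - b) = \<omega> a - \<omega> b"
  using charD(1)[OF assms(1), of "a - b" b] A_closed(6) assms by (simp add: algebra_simps)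

lemma char_p: "\<omega> \<in> \<Omega> \<Longrightarrow> \<omega> (p \<mu>) = 0 \<or> \<omega> (p \<mu>) = 1"
  using charD(2)[of \<omega> "p \<mu>" "p \<mu>"] p_in_A[of \<mu>] by (simp add: proj_op_compose)

text \<open>A character is contractive: if \<open>\<omega>(b) = 1\<close> with \<open>\<parallel>b\<parallel> < 1\<close>, the contraction
  \<open>c \<mapsto> b + bc\<close> of the complete set \<open>A\<close> has a fixed point, at which \<open>\<omega>\<close> gives \<open>\<omega>(c) = 1 + \<omega>(c)\<close>.\<close>

lemma char_bound:
  assumes \<omega>: "\<omega> \<in> \<Omega>" and a: "a \<in> A"
  shows "cmod (\<omega> a) \<le> norm a"
proof (rule ccontr)
  assume less: "\<not> cmod (\<omega> a) \<le> norm a"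
  then have nz: "\<omega> a \<noteq> 0" by auto
  define b where "b = scaleC_op (1 / \<omega> a) a"
  have b: "b \<in> A" "\<omega> b = 1"
    using a nz charD(3)[OF \<omega> a] A_closed(5) by (auto simp: b_def)
  have "norm b \<le> norm a / cmod (\<omega> a)"
  proof (rule norm_blinfun_bound)
    show "norm (b f) \<le> norm a / cmod (\<omega> a) * norm f" for f
      using divide_right_mono[OF norm_blinfun[of a f], of "cmod (\<omega> a)"]
      by (simp add: b_def scaleC_op_apply norm_scaleC norm_divide)
  qed simp
  also have "\<dots> < 1"
    using less nz by simp
  finally have "norm b < 1" .
  have "\<exists>!c. c \<in> A \<and> b + (b o\<^sub>L c) = c"
  proof (rule Banach_fix[of A "norm b" "\<lambda>c. b + (b o\<^sub>L c)"])
    show "complete A"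
      using cstar_subalgebraD(7)[OF A_subalgebra] by (simp add: complete_eq_closed)
    show "A \<noteq> {}" using a by blast
    show "(\<lambda>c. b + (b o\<^sub>L c)) ` A \<subseteq> A" using b(1) A_closed by blast
    show "dist (b + (b o\<^sub>L c)) (b + (b o\<^sub>L c')) \<le> norm b * dist c c'" for c c'
      by (simp add: dist_norm norm_blinfun_compose flip: comp_distrib(6))
  qed (use \<open>norm b < 1\<close> in auto)
  then obtain c where c: "c \<in> A" "b + (b o\<^sub>L c) = c" by blast
  have "\<omega> (b + (b o\<^sub>L c)) = 1 + \<omega> c"
    using b c(1) charD(1)[OF \<omega> b(1)] charD(2)[OF \<omega> b(1)] A_closed by simp
  then show False using c(2) by simp
qed

lemma char_tendsto:
  assumes "\<omega> \<in> \<Omega>" "\<And>n. X n \<in> A" "a \<in> A" "X \<longlonglongrightarrow> a"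
  shows "(\<lambda>n::nat. \<omega> (X n)) \<longlonglongrightarrow> \<omega> a"
proof (rule Lim_null_comparison[THEN LIM_zero_cancel])
  show "\<forall>\<^sub>F n in sequentially. norm (\<omega> (X n) - \<omega> a) \<le> norm (X n - a)"
    using assms char_bound[OF assms(1)] by (simp add: A_closed flip: char_diff)
  show "(\<lambda>n. norm (X n - a)) \<longlonglongrightarrow> 0"
    using assms(4) by (simp add: LIM_zero tendsto_norm_zero)
qed

text \<open>The words that may precede a character; \<open>past \<omega>\<^sub>\<nu>\<close> is \<open>{\<mu>. \<mu>\<nu> \<in> L}\<close> for the vector state at
  \<open>\<nu>\<close>. Read from right to left it is a tree, and the dynamics walk down this tree.\<close>

definition past :: "(word_op \<Rightarrow> complex) \<Rightarrow> nat list set"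
  where "past \<omega> = {\<mu> \<in> L. \<omega> (p \<mu>) = 1}"

text \<open>A priori a character is multiplicative but not known to respect adjoints, hence the
  adjoint in the induction.\<close>

lemma char_eqI:
  assumes "\<omega> \<in> \<Omega>" "\<omega>' \<in> \<Omega>" "past \<omega> = past \<omega>'"
  shows "\<omega> = \<omega>'"
proof (rule extensionalityI[of _ A])
  have p_eq: "\<omega> (p \<mu>) = \<omega>' (p \<mu>)" if "\<mu> \<in> L" for \<mu>
  proof -
    have "\<omega> (p \<mu>) = 1 \<longleftrightarrow> \<omega>' (p \<mu>) = 1"
      using that assms(3) by (auto simp: past_def)
    then show ?thesis using char_p[OF assms(1), of \<mu>] char_p[OF assms(2), of \<mu>] by auto
  qed
  fix a assume "a \<in> A"
  then have "\<omega> a = \<omega>' a \<and> \<omega> (adj a) = \<omega>' (adj a)"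
  proof (induction rule: A_induct)
    case (gen a)
    then show ?case using p_eq by (auto simp: adj_proj)
  next
    case zero
    have "adj (0 :: word_op) = 0"
      using adj_proj[of "{} :: nat list set"] by (simp add: proj_empty)
    then show ?case using assms by (simp add: char_zero)
  next
    case (closed X a)
    have X: "X n \<in> A" "adj (X n) \<in> A" "clinear_op (X n)" for n
      by (fact closed.hyps(1), fact A_closed(4)[OF closed.hyps(1)], fact A_clinear[OF closed.hyps(1)])
    have a: "a \<in> A" "adj a \<in> A" "clinear_op a"
      by (fact closed.hyps(3), fact A_closed(4)[OF closed.hyps(3)], fact A_clinear[OF closed.hyps(3)])
    have lim: "(\<lambda>n. adj (X n)) \<longlonglongrightarrow> adj a"
      by (rule tendsto_adj[OF closed.hyps(2) X(3) a(3)])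
    note char_lims = char_tendsto[OF _ X(1) a(1) closed.hyps(2)] char_tendsto[OF _ X(2) a(2) lim]
    have "\<omega> a = \<omega>' a"
      using LIMSEQ_unique[OF char_lims(1)[OF assms(1)]] char_lims(1)[OF assms(2)] conjunct1[OF closed.IH] by simp
    moreover have "\<omega> (adj a) = \<omega>' (adj a)"
      using LIMSEQ_unique[OF char_lims(2)[OF assms(1)]] char_lims(2)[OF assms(2)] conjunct2[OF closed.IH] by simp
    ultimately show ?case ..
  qed (use assms in \<open>simp_all add: adj_add adj_compose adj_scaleC adj_adj A_clinear A_closed charD\<close>)
  then show "\<omega> a = \<omega>' a" ..
qed (use assms charD(5) in auto)

end

context quantised_dynamics begin

section \<open>Vector states and the dynamics\<close>

lemma ket_coordinate: "proj_op {\<nu>} f = Rep_ell2 f \<nu> *\<^sub>C ket \<nu>"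
  by (rule ell2_eqI) (simp add: proj_op_Rep Rep_ell2_simps)

lemma A_ket:
  assumes "a \<in> A"
  shows "a (ket \<nu>) = Rep_ell2 (a (ket \<nu>)) \<nu> *\<^sub>C ket \<nu>"
proof -
  have "proj_op {\<nu>} (ket \<nu>) = ket \<nu>"
    by (rule ell2_eqI) (simp add: proj_op_Rep Rep_ell2_simps)
  then have "a (ket \<nu>) = (a o\<^sub>L proj_op {\<nu>}) (ket \<nu>)" by simp
  also have "\<dots> = proj_op {\<nu>} (a (ket \<nu>))" unfolding A_commute[OF assms] by simp
  finally show ?thesis by (simp only: ket_coordinate)
qed

definition state :: "nat list \<Rightarrow> word_op \<Rightarrow> complex"
  where "state \<nu> = (\<lambda>a\<in>A. Rep_ell2 (blinfun_apply a (ket \<nu>)) \<nu>)"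

lemma state_p: "state \<nu> (p \<mu>) = (if \<mu> @ \<nu> \<in> L then 1 else 0)"
proof -
  have "state \<nu> (p \<mu>) = Rep_ell2 (p \<mu> (ket \<nu>)) \<nu>"
    by (simp only: state_def restrict_apply' p_in_A)
  then show ?thesis by (simp add: proj_op_Rep Rep_ell2_simps left_quot_def)
qed

lemma char_p_L:
  assumes "\<omega> \<in> \<Omega>" "\<omega> (p \<mu>) = 1"
  shows "\<mu> \<in> L"
proof (rule ccontr)
  assume "\<mu> \<notin> L"
  then have "p \<mu> = 0" using left_quot_empty[of \<mu>] by (simp add: proj_empty)
  then show False using assms char_zero[OF assms(1)] by simp
qed

lemma state_char:
  assumes "\<nu> \<in> L"
  shows "state \<nu> \<in> \<Omega>"
  unfolding characters_def
proof (intro CollectI conjI ballI allI)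
  fix a b assume a: "a \<in> A" and b: "b \<in> A"
  show "state \<nu> (a + b) = state \<nu> a + state \<nu> b"
    using a b A_closed(2)[OF a b] by (simp add: state_def blinfun.add_left Rep_ell2_simps)
  let ?b = "Rep_ell2 (b (ket \<nu>)) \<nu>"
  have "(a o\<^sub>L b) (ket \<nu>) = a (?b *\<^sub>C ket \<nu>)"
    using A_ket[OF b, of \<nu>] by simp
  also have "\<dots> = ?b *\<^sub>C a (ket \<nu>)"
    using A_clinear[OF a] by (simp add: clinear_op_def)
  finally show "state \<nu> (a o\<^sub>L b) = state \<nu> a * state \<nu> b"
    using a b A_closed(3)[OF a b] by (simp add: state_def Rep_ell2_simps)
next
  fix a c assume a: "a \<in> A"
  show "state \<nu> (scaleC_op c a) = c * state \<nu> a"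
    using a A_closed(5)[OF a] by (simp add: state_def scaleC_op_apply Rep_ell2_simps)
next
  have "state \<nu> (p []) \<noteq> 0" using assms by (simp add: state_p)
  then show "\<exists>a\<in>A. state \<nu> a \<noteq> 0" using p_in_A by blast
qed (simp add: state_def)

lemma past_state: "past (state \<nu>) = {\<mu>. \<mu> @ \<nu> \<in> L}"
  using L_appendD(1) by (auto simp: past_def state_p)

lemma past_subset: "past \<omega> \<subseteq> L"
  by (auto simp: past_def)

lemma dyn_map_state:
  assumes "i # \<nu> \<in> L"
  shows "dyn_map d I i (state \<nu>) = state (i # \<nu>)"
proof -
  have "Rep_ell2 (\<alpha> i a (ket \<nu>)) \<nu> = Rep_ell2 (a (ket (i # \<nu>))) (i # \<nu>)" for a
  proof -
    have "Rep_ell2 (adj (shift_op L i) f) \<nu> = Rep_ell2 f (i # \<nu>)" for f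
      using adj_pull_op_Rep(1)[OF inj_on_tl, of "i # \<nu>" L i f] assms by (simp add: shift_op_pull)
    then show ?thesis using assms by (simp add: \<alpha>_eq shift_op_ket)
  qed
  then show ?thesis
    by (auto simp: dyn_map_def state_def \<alpha>_in_A)
qed

lemma dyn_map_char:
  assumes \<omega>: "\<omega> \<in> \<Omega>" and i: "[i] \<in> past \<omega>"
  shows "dyn_map d I i \<omega> \<in> \<Omega>"
proof -
  let ?\<psi> = "dyn_map d I i \<omega>"
  have eval: "?\<psi> a = \<omega> (\<alpha> i a)" if "a \<in> A" for a
    using that by (simp add: dyn_map_def)
  have "?\<psi> (proj_op L) = 1"
    using i by (simp add: eval one_in_A \<alpha>_one past_def)
  then show ?thesis
    using A_closed(2,3,5) \<alpha>_in_A charD(1-3)[OF \<omega>] one_in_A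
    unfolding characters_def
    by (auto simp: eval \<alpha>_add \<alpha>_comp \<alpha>_scale simp del: One_nat_def intro!: bexI[of _ "proj_op L"])
      (simp add: dyn_map_def)
qed

lemma past_dyn_map: "past (dyn_map d I i \<omega>) = {\<mu>. \<mu> @ [i] \<in> past \<omega>}" if "\<omega> \<in> \<Omega>"
proof -
  have "\<mu> @ [i] \<in> L" if "\<omega> (p (\<mu> @ [i])) = 1" for \<mu>
    by (rule char_p_L[OF \<open>\<omega> \<in> \<Omega>\<close> that])
  then show ?thesis
    by (auto simp: past_def dyn_map_def p_in_A \<alpha>_p dest: L_appendD(1))
qed

lemma past_suffix:
  assumes "\<omega> \<in> \<Omega>" "u @ v \<in> past \<omega>"
  shows "v \<in> past \<omega>"
proof -
  have "left_quot L (u @ v) \<subseteq> left_quot L v"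
    by (auto simp: left_quot_def dest: L_appendD)
  then have "p (u @ v) o\<^sub>L p v = p (u @ v)"
    by (simp add: proj_op_compose Int_absorb2)
  then have "\<omega> (p (u @ v)) * \<omega> (p v) = \<omega> (p (u @ v))"
    using charD(2)[OF assms(1) p_in_A p_in_A, of "u @ v" v] by simp
  then show ?thesis
    using assms(2) L_appendD(2) by (auto simp: past_def)
qed

text \<open>\<open>letters \<omega>\<close> is the unique \<open>S\<close> with \<open>\<omega> \<in> Q\<^sub>S\<close>.\<close>

definition letters :: "(word_op \<Rightarrow> complex) \<Rightarrow> nat set"
  where "letters \<omega> = {i. [i] \<in> past \<omega>}"

lemma letters_subset: "letters \<omega> \<subseteq> {1..d}"
  using past_subset L_letters by (force simp: letters_def)

lemma topspace_Omega: "topspace (Omega d I) = \<Omega>"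
  by (auto simp: Omega_def gelfand_spectrum_def characters_def dest: extensional_arb)

lemma Omega_part_iff: "\<omega> \<in> Omega_part d I i \<longleftrightarrow> \<omega> \<in> \<Omega> \<and> i \<in> letters \<omega>"
proof -
  have "\<omega> \<in> \<Omega> \<Longrightarrow> \<omega> (p [i]) = 1 \<Longrightarrow> [i] \<in> L"
    by (rule char_p_L)
  then show ?thesis
    by (auto simp: Omega_part_def topspace_Omega shift_initial_proj letters_def past_def)
qed

lemma Q_set_iff: "S \<subseteq> {1..d} \<Longrightarrow> \<omega> \<in> Q_set d I S \<longleftrightarrow> \<omega> \<in> \<Omega> \<and> letters \<omega> = S"
  using letters_subset by (auto simp: Q_set_def topspace_Omega Omega_part_iff)

lemma letters_state: "letters (state \<nu>) = {i. i # \<nu> \<in> L}"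
  by (simp add: letters_def past_state)

definition past_level :: "nat \<Rightarrow> (word_op \<Rightarrow> complex) \<Rightarrow> nat list set"
  where "past_level n \<omega> = {\<mu> \<in> past \<omega>. length \<mu> = n}"

lemma finite_past_level: "finite (past_level n \<omega>)"
  by (rule finite_subset[OF _ finite_L[of n]]) (use past_subset in \<open>auto simp: past_level_def\<close>)

lemma card_past_level_0: "\<omega> \<in> \<Omega> \<Longrightarrow> card (past_level 0 \<omega>) = 1"
proof -
  assume "\<omega> \<in> \<Omega>"
  then have "past_level 0 \<omega> = {[]}"
    using Nil_L by (auto simp: past_level_def past_def p_Nil char_one)
  then show ?thesis by simp
qed

text \<open>The last letter of a word in the past of \<open>\<omega>\<close> belongs to \<open>letters \<omega>\<close>, and the words ending in \<open>i\<close>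
  are counted by the past of \<open>\<phi>\<^sub>i(\<omega>)\<close>.\<close>

lemma card_past_level_Suc:
  assumes "\<omega> \<in> \<Omega>"
  shows "card (past_level (Suc n) \<omega>) = (\<Sum>i\<in>letters \<omega>. card (past_level n (dyn_map d I i \<omega>)))"
proof -
  let ?P = "\<lambda>i. (\<lambda>\<mu>. \<mu> @ [i]) ` past_level n (dyn_map d I i \<omega>)"
  have "past_level (Suc n) \<omega> = (\<Union>i\<in>letters \<omega>. ?P i)"
  proof (intro subset_antisym subsetI)
    fix \<mu> assume \<mu>: "\<mu> \<in> past_level (Suc n) \<omega>"
    then obtain \<nu> i where "\<mu> = \<nu> @ [i]" "length \<nu> = n"
      by (cases \<mu> rule: rev_cases) (auto simp: past_level_def)
    then show "\<mu> \<in> (\<Union>i\<in>letters \<omega>. ?P i)"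
      using \<mu> past_suffix[OF assms, of \<nu> "[i]"]
      by (auto simp: past_level_def past_dyn_map[OF assms] letters_def)
  qed (auto simp: past_level_def past_dyn_map[OF assms])
  moreover have "finite (letters \<omega>)"
    using letters_subset finite_subset by blast
  ultimately have "card (past_level (Suc n) \<omega>) = (\<Sum>i\<in>letters \<omega>. card (?P i))"
    by (simp only:) (rule card_UN_disjoint, auto simp: finite_past_level)
  also have "\<dots> = (\<Sum>i\<in>letters \<omega>. card (past_level n (dyn_map d I i \<omega>)))"
    by (simp add: card_image inj_on_def)
  finally show ?thesis .
qed


section \<open>The topology of the spectrum\<close>

text \<open>Characters that cannot be distinguished by the generators \<open>T\<^sub>\<mu>\<^sup>*T\<^sub>\<mu>\<close> with \<open>\<bar>\<mu>\<bar> \<le> N\<close>. The classes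
  of these equivalence relations turn out to be a basis of the topology.\<close>

definition agree :: "nat \<Rightarrow> (word_op \<Rightarrow> complex) \<Rightarrow> (word_op \<Rightarrow> complex) \<Rightarrow> bool"
  where "agree N \<omega> \<omega>' \<longleftrightarrow> (\<forall>\<mu>. length \<mu> \<le> N \<longrightarrow> (\<mu> \<in> past \<omega> \<longleftrightarrow> \<mu> \<in> past \<omega>'))"

lemma agree_refl: "agree N \<omega> \<omega>"
  and agree_sym: "agree N \<omega> \<omega>' \<Longrightarrow> agree N \<omega>' \<omega>"
  and agree_trans: "agree N \<omega> \<omega>' \<Longrightarrow> agree N \<omega>' \<omega>'' \<Longrightarrow> agree N \<omega> \<omega>''"
  and agree_mono: "M \<le> N \<Longrightarrow> agree N \<omega> \<omega>' \<Longrightarrow> agree M \<omega> \<omega>'"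
  by (auto simp: agree_def)

lemma agree_all: "\<omega> \<in> \<Omega> \<Longrightarrow> \<omega>' \<in> \<Omega> \<Longrightarrow> (\<And>N. agree N \<omega> \<omega>') \<Longrightarrow> \<omega> = \<omega>'"
  by (rule char_eqI) (auto simp: agree_def)

lemma agree_letters: "agree N \<omega> \<omega>' \<Longrightarrow> 1 \<le> N \<Longrightarrow> letters \<omega> = letters \<omega>'"
  by (auto simp: agree_def letters_def)

lemma continuous_map_eval:
  "a \<in> A \<Longrightarrow> continuous_map (product_topology (\<lambda>_. euclidean) A) euclidean (\<lambda>\<omega>. \<omega> a)"
  by (rule continuous_map_product_projection)

lemma openin_past: "openin (Omega d I) {\<omega> \<in> \<Omega>. \<mu> \<in> past \<omega> \<longleftrightarrow> b}"
proof (cases "\<mu> \<in> L")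
  case True
  have cont: "continuous_map (Omega d I) euclidean (\<lambda>\<omega>. \<omega> (p \<mu>))"
    unfolding Omega_def gelfand_spectrum_def
    by (intro continuous_map_from_subtopology continuous_map_eval p_in_A)
  have "{\<omega> \<in> \<Omega>. \<mu> \<in> past \<omega> \<longleftrightarrow> b} = {\<omega> \<in> \<Omega>. \<omega> (p \<mu>) \<in> - {if b then 0 else 1}}"
  proof (intro Collect_cong conj_cong refl)
    fix \<omega> assume "\<omega> \<in> \<Omega>"
    then show "(\<mu> \<in> past \<omega> \<longleftrightarrow> b) \<longleftrightarrow> \<omega> (p \<mu>) \<in> - {if b then 0 else 1}"
      using char_p[of \<omega> \<mu>] True by (auto simp: past_def)
  qed
  moreover have "openin (Omega d I) \<dots>"
    unfolding topspace_Omega[symmetric]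
    by (rule openin_continuous_map_preimage[OF cont]) (simp add: open_Compl)
  ultimately show ?thesis by simp
next
  case False
  then have "{\<omega> \<in> \<Omega>. \<mu> \<in> past \<omega> \<longleftrightarrow> b} = (if b then {} else topspace (Omega d I))"
    using past_subset by (auto simp: topspace_Omega)
  then show ?thesis by simp
qed

lemma openin_cylinder:
  "openin (Omega d I) {\<omega>' \<in> \<Omega>. agree N \<omega> \<omega>'}"
proof -
  let ?M = "{\<mu> \<in> L. length \<mu> \<le> N}"
  have "{\<omega>' \<in> \<Omega>. agree N \<omega> \<omega>'} = (\<Inter>\<mu>\<in>?M. {\<omega>' \<in> \<Omega>. \<mu> \<in> past \<omega>' \<longleftrightarrow> \<mu> \<in> past \<omega>}) \<inter> topspace (Omega d I)"
    using past_subset by (fastforce simp: agree_def topspace_Omega)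
  then show ?thesis
    using openin_INT[OF finite_L[of N] openin_past] by simp
qed

lemma openin_saturated:
  assumes "U \<subseteq> \<Omega>" "\<And>\<omega> \<omega>'. \<omega> \<in> U \<Longrightarrow> \<omega>' \<in> \<Omega> \<Longrightarrow> agree N \<omega> \<omega>' \<Longrightarrow> \<omega>' \<in> U"
  shows "openin (Omega d I) U"
proof (subst openin_subopen, intro ballI)
  fix \<omega> assume "\<omega> \<in> U"
  then show "\<exists>T. openin (Omega d I) T \<and> \<omega> \<in> T \<and> T \<subseteq> U"
    using assms agree_refl by (intro exI[of _ "{\<omega>' \<in> \<Omega>. agree N \<omega> \<omega>'}"] conjI openin_cylinder) auto
qed

lemma closedin_saturated:
  assumes "U \<subseteq> \<Omega>" "\<And>\<omega> \<omega>'. \<omega> \<in> U \<Longrightarrow> \<omega>' \<in> \<Omega> \<Longrightarrow> agree N \<omega> \<omega>' \<Longrightarrow> \<omega>' \<in> U"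
  shows "closedin (Omega d I) U"
  unfolding closedin_def topspace_Omega
  by (intro conjI openin_saturated[of _ N]) (use assms agree_sym in blast)+

lemma continuous_map_field:
  fixes f g :: "'a \<Rightarrow> complex"
  assumes "continuous_map X euclidean f" "continuous_map X euclidean g"
  shows "continuous_map X euclidean (\<lambda>x. f x + g x)" "continuous_map X euclidean (\<lambda>x. f x * g x)"
  using assms by (simp_all add: continuous_map_atin tendsto_mult tendsto_add)

text \<open>The Banach--Alaoglu argument: contractivity places the characters in a product of discs, where they are the solutions of
  closed conditions, with \<open>\<omega>(1) = 1\<close> in the role of \<open>\<omega> \<noteq> 0\<close>.\<close>

lemma compact_space_Omega: "compact_space (Omega d I)"
proof -
  let ?X = "product_topology (\<lambda>_. euclidean :: complex topology) A"
  let ?K = "PiE A (\<lambda>a. cball 0 (norm a))"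
  let ?C = "\<lambda>a b. {\<omega> \<in> topspace ?X. \<omega> (a + b) = \<omega> a + \<omega> b} \<inter>
    {\<omega> \<in> topspace ?X. \<omega> (a o\<^sub>L b) = \<omega> a * \<omega> b}"
  let ?S = "\<lambda>a. \<Inter>c. {\<omega> \<in> topspace ?X. \<omega> (scaleC_op c a) = c * \<omega> a}"
  let ?O = "{\<omega> \<in> topspace ?X. \<omega> (proj_op L) = 1}"
  let ?Z = "(\<Inter>a\<in>A. (\<Inter>b\<in>A. ?C a b) \<inter> ?S a) \<inter> ?O"
  note eq = closedin_continuous_maps_eq[OF Hausdorff_space_euclidean]
  have "A \<noteq> {}" using one_in_A by blast
  have C: "closedin ?X (?C a b)" if "a \<in> A" "b \<in> A" for a b
    using that A_closed(2,3)
    by (intro closedin_Int eq continuous_map_field continuous_map_eval) auto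
  have S: "closedin ?X (?S a)" if "a \<in> A" for a
    using that A_closed(5)
    by (intro closedin_INT eq continuous_map_field continuous_map_eval) auto
  have "closedin ?X ?O"
    by (intro eq continuous_map_eval one_in_A) simp
  moreover have "closedin ?X (\<Inter>b\<in>A. ?C a b)" if "a \<in> A" for a
    by (rule closedin_INT[OF \<open>A \<noteq> {}\<close> C[OF that]])
  then have "closedin ?X (\<Inter>a\<in>A. (\<Inter>b\<in>A. ?C a b) \<inter> ?S a)"
    by (rule closedin_INT[OF \<open>A \<noteq> {}\<close> closedin_Int[OF _ S]])
  ultimately have Z: "closedin ?X ?Z"
    by (intro closedin_Int)
  have K: "compactin ?X ?K"
    by (simp add: compactin_PiE)
  have "\<Omega> = ?K \<inter> ?Z"
  proof (intro subset_antisym subsetI)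
    fix \<omega> assume \<omega>: "\<omega> \<in> \<Omega>"
    then show "\<omega> \<in> ?K \<inter> ?Z"
      using char_bound[OF \<omega>] charD[OF \<omega>] char_one[OF \<omega>] by (simp add: PiE_iff)
  next
    fix \<omega> assume "\<omega> \<in> ?K \<inter> ?Z"
    then show "\<omega> \<in> \<Omega>"
      using one_in_A by (auto simp: characters_def PiE_iff intro!: bexI[of _ "proj_op L"])
  qed
  then have "compactin ?X \<Omega>"
    using compact_Int_closedin[OF K Z] by (simp only:)
  then show ?thesis
    unfolding Omega_def gelfand_spectrum_def by (rule compact_space_subtopology)
qed

text \<open>The intersection of the classes of \<open>\<omega>\<close> for all \<open>N\<close> is \<open>{\<omega>}\<close>, so by compactness one of these
  closed sets is already contained in \<open>V\<close>.\<close>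

lemma cylinder_neighbourhood:
  assumes V: "openin (Omega d I) V" and \<omega>: "\<omega> \<in> V"
  shows "\<exists>N. \<forall>\<omega>'\<in>\<Omega>. agree N \<omega> \<omega>' \<longrightarrow> \<omega>' \<in> V"
proof (rule ccontr)
  assume contra: "\<not> ?thesis"
  have "\<omega> \<in> \<Omega>" using openin_subset[OF V] \<omega> by (auto simp: topspace_Omega)
  define C where "C N = {\<omega>' \<in> \<Omega>. agree N \<omega> \<omega>'} \<inter> (\<Omega> - V)" for N
  have "(\<Inter>N. C N) \<noteq> {}"
  proof (rule compact_space_imp_nest[OF compact_space_Omega])
    show "closedin (Omega d I) (C N)" for N
    proof -
      have "closedin (Omega d I) {\<omega>' \<in> \<Omega>. agree N \<omega> \<omega>'}"
        by (rule closedin_saturated[of _ N]) (auto intro: agree_trans)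
      moreover have "closedin (Omega d I) (\<Omega> - V)"
        using V closedin_diff[of "Omega d I" \<Omega> V] closedin_topspace[of "Omega d I"]
        by (simp add: topspace_Omega)
      ultimately show ?thesis unfolding C_def by (rule closedin_Int)
    qed
    show "C N \<noteq> {}" for N using contra by (auto simp: C_def)
    show "decseq C" by (auto simp: decseq_def C_def intro: agree_mono)
  qed
  then obtain \<omega>' where "\<And>N. \<omega>' \<in> C N" by blast
  then have "\<omega>' \<in> \<Omega>" "\<omega>' \<notin> V" "\<And>N. agree N \<omega> \<omega>'" by (auto simp: C_def)
  then show False using agree_all[OF \<open>\<omega> \<in> \<Omega>\<close>] \<omega> by blast
qed

text \<open>A Lebesgue number argument: data that can be chosen locally can be chosen as a function of
  the words of length at most \<open>N\<close> in the past of a character, for some \<open>N\<close>.\<close>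

lemma locally_constant_choice:
  assumes loc: "\<And>\<omega>. \<omega> \<in> \<Omega> \<Longrightarrow> \<exists>V x. openin (Omega d I) V \<and> \<omega> \<in> V \<and> (\<forall>\<omega>'\<in>V. R \<omega>' x)"
  shows "\<exists>N f. (\<forall>\<omega>\<in>\<Omega>. R \<omega> (f \<omega>)) \<and> (\<forall>\<omega>\<in>\<Omega>. \<forall>\<omega>'\<in>\<Omega>. agree N \<omega> \<omega>' \<longrightarrow> f \<omega> = f \<omega>')"
proof -
  define good where "good N \<omega> x \<longleftrightarrow> (\<forall>\<omega>'\<in>\<Omega>. agree N \<omega> \<omega>' \<longrightarrow> R \<omega>' x)" for N \<omega> x
  define C where "C N = {\<omega> \<in> \<Omega>. \<nexists>x. good N \<omega> x}" for N
  have good_cong: "good N \<omega> = good N \<omega>'" if "agree N \<omega> \<omega>'" for N \<omega> \<omega>'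
    using that agree_trans agree_sym unfolding good_def by (intro ext) blast
  (* The sets C N decrease and are closed; if none were empty, compactness would give a character at
     which the local choice fails on all scales. *)
  have "\<exists>N. C N = {}"
  proof (rule ccontr)
    assume contra: "\<nexists>N. C N = {}"
    have "(\<Inter>N. C N) \<noteq> {}"
    proof (rule compact_space_imp_nest[OF compact_space_Omega])
      show "closedin (Omega d I) (C N)" for N
        by (rule closedin_saturated[of _ N]) (auto simp: C_def dest: good_cong)
      show "C N \<noteq> {}" for N using contra by blast
      show "decseq C"
        using agree_mono unfolding decseq_def C_def good_def by blast
    qed
    then obtain \<omega> where \<omega>: "\<And>N. \<omega> \<in> C N" by blast
    then have "\<omega> \<in> \<Omega>" by (auto simp: C_def)
    then obtain V x where V: "openin (Omega d I) V" "\<omega> \<in> V" "\<forall>\<omega>'\<in>V. R \<omega>' x"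
      using loc by blast
    then obtain N where "\<forall>\<omega>'\<in>\<Omega>. agree N \<omega> \<omega>' \<longrightarrow> \<omega>' \<in> V"
      using cylinder_neighbourhood by blast
    then have "good N \<omega> x" using V(3) by (simp add: good_def)
    then show False using \<omega>[of N] by (auto simp: C_def)
  qed
  then obtain N where N: "C N = {}" by blast
  (* The predicate good N is the same for all members of a class, hence so is the chosen value. *)
  define f where "f \<omega> = (SOME x. good N \<omega> x)" for \<omega>
  have "R \<omega> (f \<omega>)" if "\<omega> \<in> \<Omega>" for \<omega>
  proof -
    have "\<exists>x. good N \<omega> x" using N that by (auto simp: C_def)
    then have "good N \<omega> (f \<omega>)" unfolding f_def by (rule someI_ex)
    then show ?thesis using that agree_refl by (auto simp: good_def)
  qed
  moreover have "f \<omega> = f \<omega>'" if "agree N \<omega> \<omega>'" for \<omega> \<omega>'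
    using good_cong[OF that] by (simp add: f_def)
  ultimately show ?thesis by blast
qed

text \<open>If membership in \<open>E\<close> depends on finitely many of the sets \<open>{\<nu>. \<mu>\<nu> \<in> L}\<close>, then \<open>E\<close> is a Boolean
  combination of them. The induction splits \<open>E\<close> along one of these sets; \<open>E1\<close> and \<open>E2\<close> are the two
  parts, enlarged so that they depend on the remaining sets only.\<close>

lemma proj_finitely_determined:
  assumes "finite M" "E \<subseteq> L"
    and "\<And>\<nu> \<nu>'. \<nu> \<in> E \<Longrightarrow> \<nu>' \<in> L \<Longrightarrow> (\<And>\<mu>. \<mu> \<in> M \<Longrightarrow> \<mu> @ \<nu> \<in> L \<longleftrightarrow> \<mu> @ \<nu>' \<in> L) \<Longrightarrow> \<nu>' \<in> E"
  shows "proj_op E \<in> A"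
  using assms
proof (induction M arbitrary: E rule: finite_induct)
  case empty
  then have "E = {} \<or> E = L" by blast
  then show ?case using one_in_A A_closed(1) by (auto simp: proj_empty)
next
  case (insert \<mu> M)
  define same where "same \<nu> \<nu>' \<longleftrightarrow> (\<forall>\<kappa>\<in>M. \<kappa> @ \<nu> \<in> L \<longleftrightarrow> \<kappa> @ \<nu>' \<in> L)" for \<nu> \<nu>'
  define E1 where "E1 = {\<nu>' \<in> L. \<exists>\<nu>\<in>E. \<mu> @ \<nu> \<in> L \<and> same \<nu> \<nu>'}"
  define E2 where "E2 = {\<nu>' \<in> L. \<exists>\<nu>\<in>E. \<mu> @ \<nu> \<notin> L \<and> same \<nu> \<nu>'}"
  have E1: "proj_op E1 \<in> A" and E2: "proj_op E2 \<in> A"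
    by (rule insert.IH; force simp: E1_def E2_def same_def)+
  have E: "\<nu> \<in> E \<longleftrightarrow> (if \<nu> \<in> left_quot L \<mu> then \<nu> \<in> E1 else \<nu> \<in> E2)" for \<nu>
  proof -
    have "same \<nu> \<nu>" by (simp add: same_def)
    moreover have "\<nu>' \<in> E" if "\<nu> \<in> E" "\<nu>' \<in> L" "same \<nu> \<nu>'" "\<mu> @ \<nu> \<in> L \<longleftrightarrow> \<mu> @ \<nu>' \<in> L" for \<nu> \<nu>'
      using insert.prems(2)[OF that(1,2)] that(3,4) by (auto simp: same_def)
    ultimately show ?thesis
      using insert.prems(1) unfolding E1_def E2_def left_quot_def by auto
  qed
  have "proj_op E = (p \<mu> o\<^sub>L proj_op E1) + (proj_op E2 - (p \<mu> o\<^sub>L proj_op E2))"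
    by (rule op_eqI) (simp add: proj_op_Rep E blinfun.add_left blinfun.diff_left Rep_ell2_simps)
  moreover have "\<dots> \<in> A"
    by (intro A_closed E1 E2 p_in_A)
  ultimately show ?case by simp
qed

lemma proj_saturated:
  assumes "E \<subseteq> L"
    and "\<And>\<nu> \<nu>'. \<nu> \<in> E \<Longrightarrow> \<nu>' \<in> L \<Longrightarrow> agree N (state \<nu>) (state \<nu>') \<Longrightarrow> \<nu>' \<in> E"
  shows "proj_op E \<in> A"
proof (rule proj_finitely_determined[OF finite_L[of N] assms(1)])
  fix \<nu> \<nu>' assume "\<nu> \<in> E" "\<nu>' \<in> L"
    "\<And>\<mu>. \<mu> \<in> {w \<in> L. length w \<le> N} \<Longrightarrow> \<mu> @ \<nu> \<in> L \<longleftrightarrow> \<mu> @ \<nu>' \<in> L"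
  moreover from this(3) have "agree N (state \<nu>) (state \<nu>')"
    unfolding agree_def past_state using L_appendD(1) by blast
  ultimately show "\<nu>' \<in> E" using assms(2) by blast
qed

end

section \<open>Conjugation by a unitary\<close>

text \<open>\<open>V\<close> maps the subspace of \<open>X\<close> unitarily onto the subspace of \<open>Y\<close> and vanishes on its
  complement.\<close>

locale unitary_between =
  fixes V :: "'a ell2 \<Rightarrow>\<^sub>L 'a ell2" and X Y :: "'a set"
  assumes clinear_V: "clinear_op V"
    and adj_V_V: "adj V o\<^sub>L V = proj_op X"
    and V_adj_V: "V o\<^sub>L adj V = proj_op Y"
begin

definition conj_op :: "('a ell2 \<Rightarrow>\<^sub>L 'a ell2) \<Rightarrow> ('a ell2 \<Rightarrow>\<^sub>L 'a ell2)"
  where "conj_op a = V o\<^sub>L a o\<^sub>L adj V"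

lemma unitary_adj: "unitary_between (adj V) Y X"
  by unfold_locales (simp_all add: clinear_adj clinear_V adj_adj adj_V_V V_adj_V)

lemma norm_V_le: "norm (V f) \<le> norm f"
proof -
  have proj: "proj_op X = pull_op X (\<lambda>x. x)"
    by (rule op_eqI) (simp add: proj_op_Rep pull_op_Rep)
  have "cinner (V f) (V f) = cinner f (proj_op X f)"
    by (simp add: cinner_adj clinear_V flip: adj_V_V)
  moreover have "(norm (V f))\<^sup>2 = Re (cinner (V f) (V f))"
    by (simp add: dot_square_norm flip: inner_ell2_def)
  ultimately have "(norm (V f))\<^sup>2 = Re (cinner f (proj_op X f))"
    by simp
  also have "\<dots> \<le> norm f * norm (proj_op X f)"
    using cinner_Cauchy_Schwarz complex_Re_le_cmod order_trans by blast
  also have "\<dots> \<le> (norm f)\<^sup>2"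
    unfolding proj power2_eq_square by (intro mult_left_mono norm_pull_op_le norm_ge_zero)
  finally show ?thesis by (simp add: abs_le_square_iff[symmetric])
qed

lemma conj_op_linear:
  "conj_op (a + b) = conj_op a + conj_op b"
  "conj_op 0 = 0"
  "conj_op (scaleC_op c a) = scaleC_op c (conj_op a)"
  by (simp_all add: conj_op_def comp_distrib scaleC_op_simps clinear_V)

lemma conj_op_comp:
  assumes "a \<in> bounded_ops X"
  shows "conj_op (a o\<^sub>L b) = conj_op a o\<^sub>L conj_op b"
proof -
  have "conj_op a o\<^sub>L conj_op b = V o\<^sub>L (a o\<^sub>L (adj V o\<^sub>L V)) o\<^sub>L b o\<^sub>L adj V"
    by (simp add: conj_op_def comp_assoc)
  also have "a o\<^sub>L (adj V o\<^sub>L V) = a"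
    using assms by (simp add: adj_V_V bounded_ops_def)
  finally show ?thesis by (simp add: conj_op_def comp_assoc)
qed

lemma conj_op_adj: "clinear_op a \<Longrightarrow> conj_op (adj a) = adj (conj_op a)"
  by (simp add: conj_op_def adj_compose clinear_op_simps clinear_adj clinear_V adj_adj comp_assoc)

lemma conj_op_one: "conj_op (proj_op X) = proj_op Y"
proof -
  have "conj_op (proj_op X) = (V o\<^sub>L adj V) o\<^sub>L (V o\<^sub>L adj V)"
    by (simp add: conj_op_def comp_assoc flip: adj_V_V)
  then show ?thesis by (simp add: V_adj_V proj_op_compose)
qed

lemma conj_op_bounded:
  assumes "a \<in> bounded_ops X"
  shows "conj_op a \<in> bounded_ops Y"
proof -
  (* The kernel of V contains the complement of the subspace of X, because V^*V vanishes there. *)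
  have VVV: "V o\<^sub>L adj V o\<^sub>L V = V" "adj V o\<^sub>L (V o\<^sub>L adj V) = adj V"
  proof -
    have "norm (V (f - proj_op X f)) = 0" for f
    proof -
      let ?g = "f - proj_op X f"
      have "proj_op X ?g = 0"
        by (rule ell2_eqI) (simp add: proj_op_Rep Rep_ell2_simps)
      then have "adj V (V ?g) = 0"
        by (metis adj_V_V blinfun_apply_blinfun_compose)
      then have "cinner (V ?g) (V ?g) = cinner ?g 0"
        by (simp only: cinner_adj[OF clinear_V])
      then show ?thesis
        by (simp add: norm_ell2_def inner_ell2_def cinner.rep_eq[of _ 0] zero_ell2.rep_eq)
    qed
    then have "V o\<^sub>L proj_op X = V"
      by (intro blinfun_eqI) (simp add: blinfun.diff_right)
    then show 1: "V o\<^sub>L adj V o\<^sub>L V = V"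
      by (simp add: comp_assoc adj_V_V)
    have "adj (V o\<^sub>L adj V o\<^sub>L V) = adj V" by (simp only: 1)
    then show "adj V o\<^sub>L (V o\<^sub>L adj V) = adj V"
      by (simp add: adj_compose clinear_op_simps clinear_adj clinear_V adj_adj)
  qed
  have "proj_op Y o\<^sub>L conj_op a = (V o\<^sub>L adj V o\<^sub>L V) o\<^sub>L a o\<^sub>L adj V"
    by (simp add: conj_op_def comp_assoc flip: V_adj_V)
  moreover have "conj_op a o\<^sub>L proj_op Y = V o\<^sub>L a o\<^sub>L (adj V o\<^sub>L (V o\<^sub>L adj V))"
    by (simp add: conj_op_def comp_assoc flip: V_adj_V)
  ultimately have "proj_op Y o\<^sub>L conj_op a = conj_op a" "conj_op a o\<^sub>L proj_op Y = conj_op a"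
    unfolding VVV by (simp_all add: conj_op_def)
  then show ?thesis
    using assms by (simp add: bounded_ops_def conj_op_def clinear_op_simps clinear_V clinear_adj)
qed

lemma conj_op_inverse:
  assumes "a \<in> bounded_ops X"
  shows "unitary_between.conj_op (adj V) (conj_op a) = a"
proof -
  interpret W: unitary_between "adj V" Y X by (rule unitary_adj)
  have "W.conj_op (conj_op a) = (adj V o\<^sub>L V) o\<^sub>L a o\<^sub>L (adj V o\<^sub>L V)"
    by (simp add: W.conj_op_def conj_op_def adj_adj clinear_V comp_assoc)
  then show ?thesis using assms by (simp add: adj_V_V bounded_ops_def)
qed

text \<open>Since \<open>V\<^sup>*\<close> is contractive, the image of the unit ball under \<open>VaV\<^sup>*\<close> lies in the image under \<open>V\<close> of
  the compact set \<open>closure (a ` cball 0 1)\<close>.\<close>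

lemma conj_op_compact:
  assumes a: "a \<in> compact_ops X"
  shows "conj_op a \<in> compact_ops Y"
proof -
  interpret W: unitary_between "adj V" Y X by (rule unitary_adj)
  let ?K = "closure (blinfun_apply a ` cball 0 1)"
  have K: "compact (V ` ?K)"
    using a by (intro compact_continuous_image) (auto simp: compact_ops_def intro!: continuous_intros)
  have "blinfun_apply (conj_op a) ` cball 0 1 \<subseteq> V ` ?K"
  proof (clarsimp simp: conj_op_def)
    fix f :: "'a ell2" assume "norm f \<le> 1"
    then have "adj V f \<in> cball 0 1"
      using W.norm_V_le[of f] by simp
    then show "V (a (adj V f)) \<in> V ` ?K"
      by (intro imageI subsetD[OF closure_subset])
  qed
  then have "closure (blinfun_apply (conj_op a) ` cball 0 1) \<subseteq> V ` ?K"
    using K by (simp add: closure_minimal compact_imp_closed)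
  then have "V ` ?K \<inter> closure (blinfun_apply (conj_op a) ` cball 0 1)
      = closure (blinfun_apply (conj_op a) ` cball 0 1)"
    by (rule Int_absorb1)
  then have "compact (closure (blinfun_apply (conj_op a) ` cball 0 1))"
    using compact_Int_closed[OF K closed_closure, of "blinfun_apply (conj_op a) ` cball 0 1"]
    by (simp only:)
  moreover have "a \<in> bounded_ops X"
    using a by (simp add: compact_ops_def)
  ultimately show ?thesis
    using conj_op_bounded unfolding compact_ops_def by blast
qed

lemma conj_op_generated:
  assumes "S \<subseteq> bounded_ops X" "cstar_subalgebra Y B" "\<And>g. g \<in> S \<Longrightarrow> conj_op g \<in> B"
    and a: "a \<in> cstar_generated X S"
  shows "conj_op a \<in> B"
  using a assms(1)
proof (induction rule: cstar_generated_induct)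
  note G = cstar_subalgebraD[OF cstar_generated_subalgebra[OF assms(1)]]
  note B = cstar_subalgebraD[OF assms(2)]
  {
    case (gen a)
    then show ?case by (rule assms(3))
  next
    case zero
    then show ?case using B(2) by (simp add: conj_op_linear)
  next
    case (add a b)
    then show ?case using B(3) by (simp add: conj_op_linear)
  next
    case (comp a b)
    then have "a \<in> bounded_ops X" using G(1) by blast
    then show ?case using comp.IH B(4) by (simp add: conj_op_comp)
  next
    case (adj a)
    then show ?case using B(5) G(8) by (simp add: conj_op_adj)
  next
    case (scale a c)
    then show ?case using B(6) by (simp add: conj_op_linear)
  next
    case (closed Z a)
    have "(\<lambda>n. conj_op (Z n)) \<longlonglongrightarrow> conj_op a"
      unfolding conj_op_def
      by (intro bounded_bilinear.tendsto[OF bounded_bilinear_blinfun_compose] closed.hyps tendsto_const)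
    then show ?case by (rule closed_sequentially[OF B(7) closed.IH])
  }
qed

end

text \<open>Conjugation maps the compact operators of one space onto those of the other, hence cosets to
  cosets. The operations of the quotient are unions over elements of cosets, and taking images
  commutes with unions, so the image map on cosets is the isomorphism of the quotients.\<close>

lemma star_isomorphic_by_conjugation:
  fixes V :: "'a ell2 \<Rightarrow>\<^sub>L 'a ell2"
  assumes "unitary_between V X Y"
    and BX: "cstar_subalgebra X BX" and BY: "cstar_subalgebra Y BY"
    and into: "\<And>a. a \<in> BX \<Longrightarrow> unitary_between.conj_op V a \<in> BY"
    and onto: "\<And>b. b \<in> BY \<Longrightarrow> unitary_between.conj_op (adj V) b \<in> BX"
  shows "op_star_algebra X BX \<simeq>\<^sub>* op_star_algebra Y BY"
    and "quotient_star_algebra (op_star_algebra X BX) (compact_ops X)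
      \<simeq>\<^sub>* quotient_star_algebra (op_star_algebra Y BY) (compact_ops Y)"
proof -
  interpret V: unitary_between V X Y by (rule assms(1))
  interpret W: unitary_between "adj V" Y X by (rule V.unitary_adj)
  let ?h = V.conj_op and ?k = W.conj_op
  let ?A = "op_star_algebra X BX" and ?B = "op_star_algebra Y BY"
  let ?K = "compact_ops X" and ?M = "compact_ops Y"
  have adj_adj_V: "adj (adj V) = V" by (simp add: adj_adj V.clinear_V)
  have kh: "?k (?h a) = a" if "a \<in> bounded_ops X" for a
    using V.conj_op_inverse[OF that] .
  have hk: "?h (?k b) = b" if "b \<in> bounded_ops Y" for b
    using W.conj_op_inverse[OF that] by (simp add: adj_adj_V)
  note BX_bdd = subsetD[OF cstar_subalgebraD(1)[OF BX]]
  note BY_bdd = subsetD[OF cstar_subalgebraD(1)[OF BY]]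
  have h_BX: "?h ` BX = BY"
    using into onto hk BY_bdd by (metis image_eqI image_subset_iff subsetI subset_antisym)
  have inj: "inj_on ?h (bounded_ops X)"
    by (rule inj_on_inverseI[of _ ?k]) (rule kh)
  have "bij_betw ?h BX BY"
    using inj_on_subset[OF inj] BX_bdd h_BX by (auto simp: bij_betw_def)
  then show "?A \<simeq>\<^sub>* ?B"
    unfolding star_isomorphic_def ring_iso_def ring_hom_def
    by (intro bexI[of _ ?h])
      (auto simp: op_star_algebra_def V.conj_op_linear V.conj_op_comp V.conj_op_one V.conj_op_adj
        into BX_bdd cstar_subalgebraD(8)[OF BX])

  have K_bdd: "?K \<subseteq> bounded_ops X" "?M \<subseteq> bounded_ops Y"
    by (auto simp: compact_ops_def)
  have h_K: "?h ` ?K = ?M"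
  proof (intro subset_antisym subsetI)
    fix b assume b: "b \<in> ?M"
    then have "b = ?h (?k b)" "?k b \<in> ?K"
      using hk K_bdd W.conj_op_compact by auto
    then show "b \<in> ?h ` ?K" by blast
  qed (use V.conj_op_compact in blast)
  have coset: "S +>\<^bsub>op_star_algebra Z C\<^esub> a = (\<lambda>k. k + a) ` S" for S :: "('a ell2 \<Rightarrow>\<^sub>L 'a ell2) set" and Z C a
    by (auto simp: a_r_coset_def r_coset_def op_star_algebra_def)
  have h_coset: "?h ` (?K +>\<^bsub>?A\<^esub> a) = ?M +>\<^bsub>?B\<^esub> ?h a" for a
    unfolding coset h_K[symmetric] by (auto simp: V.conj_op_linear image_iff)
  have coset_bdd: "?K +>\<^bsub>?A\<^esub> a \<subseteq> bounded_ops X" if "a \<in> BX" for a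
    unfolding coset using cstar_subalgebraD(3)[OF cstar_subalgebra_bounded_ops] K_bdd BX_bdd[OF that]
    by blast

  let ?Q = "quotient_star_algebra ?A ?K" and ?R = "quotient_star_algebra ?B ?M"
  have carrier_Q: "carrier ?Q = (\<lambda>a. ?K +>\<^bsub>?A\<^esub> a) ` BX"
    by (auto simp: quotient_star_algebra_def FactRing_def A_RCOSETS_defs a_r_coset_def r_coset_def
        op_star_algebra_def)
  have carrier_R: "carrier ?R = (\<lambda>b. ?M +>\<^bsub>?B\<^esub> b) ` BY"
    by (auto simp: quotient_star_algebra_def FactRing_def A_RCOSETS_defs a_r_coset_def r_coset_def
        op_star_algebra_def)
  have Q_bdd: "C \<subseteq> bounded_ops X" if "C \<in> carrier ?Q" for C
    using that coset_bdd by (auto simp: carrier_Q)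
  have image_carrier: "(`) ?h ` carrier ?Q = carrier ?R"
  proof -
    have "(`) ?h ` carrier ?Q = (\<lambda>b. ?M +>\<^bsub>?B\<^esub> b) ` (?h ` BX)"
      by (simp only: carrier_Q image_image h_coset)
    then show ?thesis by (simp only: h_BX carrier_R)
  qed
  have "inj_on ((`) ?h) (carrier ?Q)"
    by (rule inj_onI) (metis Q_bdd inj inj_on_image_eq_iff)
  then have bij: "bij_betw ((`) ?h) (carrier ?Q) (carrier ?R)"
    using image_carrier by (simp add: bij_betw_def)
  have mult: "?h ` (C \<otimes>\<^bsub>?Q\<^esub> D) = ?h ` C \<otimes>\<^bsub>?R\<^esub> ?h ` D" if "C \<in> carrier ?Q" "D \<in> carrier ?Q" for C D
  proof -
    have "?h ` (C \<otimes>\<^bsub>?Q\<^esub> D) = (\<Union>a\<in>C. \<Union>b\<in>D. ?h ` (?K +>\<^bsub>?A\<^esub> (a o\<^sub>L b)))"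
      by (simp add: quotient_star_algebra_def FactRing_def rcoset_mult_def op_star_algebra_def image_UN)
    also have "\<dots> = (\<Union>a\<in>C. \<Union>b\<in>D. ?M +>\<^bsub>?B\<^esub> (?h a o\<^sub>L ?h b))"
      using Q_bdd[OF that(1)] by (intro SUP_cong refl) (auto simp: h_coset V.conj_op_comp)
    finally show ?thesis
      by (simp add: quotient_star_algebra_def FactRing_def rcoset_mult_def op_star_algebra_def)
  qed
  have add: "?h ` (C \<oplus>\<^bsub>?Q\<^esub> D) = ?h ` C \<oplus>\<^bsub>?R\<^esub> ?h ` D" for C D
    by (force simp: quotient_star_algebra_def FactRing_def set_add_def set_mult_def op_star_algebra_def
        V.conj_op_linear)
  have one: "?h ` \<one>\<^bsub>?Q\<^esub> = \<one>\<^bsub>?R\<^esub>"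
    using h_coset[of "proj_op X"]
    by (simp add: quotient_star_algebra_def FactRing_def V.conj_op_one) (simp add: op_star_algebra_def V.conj_op_one)
  have star: "?h ` star ?Q C = star ?R (?h ` C)" if "C \<in> carrier ?Q" for C
  proof -
    have cl: "clinear_op a" if "a \<in> C" for a
      using that Q_bdd[OF \<open>C \<in> carrier ?Q\<close>] bounded_ops_clinear by blast
    have "?h ` star ?Q C = (\<Union>a\<in>C. ?h ` (?K +>\<^bsub>?A\<^esub> adj a))"
      by (simp add: quotient_star_algebra_def op_star_algebra_def image_UN)
    also have "\<dots> = (\<Union>a\<in>C. ?M +>\<^bsub>?B\<^esub> adj (?h a))"
      using cl by (intro SUP_cong refl) (simp add: h_coset V.conj_op_adj)
    finally show ?thesis by (simp add: quotient_star_algebra_def op_star_algebra_def)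
  qed
  have smult: "?h ` (c \<odot>\<^bsub>?Q\<^esub> C) = c \<odot>\<^bsub>?R\<^esub> ?h ` C" for c C
  proof -
    have "?h ` (c \<odot>\<^bsub>?Q\<^esub> C) = (\<Union>a\<in>C. ?h ` (?K +>\<^bsub>?A\<^esub> scaleC_op c a))"
      by (simp add: quotient_star_algebra_def op_star_algebra_def image_UN)
    also have "\<dots> = (\<Union>a\<in>C. ?M +>\<^bsub>?B\<^esub> scaleC_op c (?h a))"
      by (intro SUP_cong refl) (simp add: h_coset V.conj_op_linear)
    finally show ?thesis by (simp add: quotient_star_algebra_def op_star_algebra_def)
  qed
  have "(`) ?h \<in> ring_iso ?Q ?R"
    unfolding ring_iso_def
  proof (intro CollectI conjI ring_hom_memI)
    show "?h ` C \<in> carrier ?R" if "C \<in> carrier ?Q" for C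
      using that image_carrier by blast
  qed (use bij mult add one in auto)
  then show "?Q \<simeq>\<^sub>* ?R"
    unfolding star_isomorphic_def using star smult by (intro bexI[of _ "(`) ?h"]) auto
qed

section \<open>Relabelling words\<close>

context quantised_dynamics begin

lemma shift_bounded: "shift_op L i \<in> bounded_ops L"
proof -
  have "proj_op L o\<^sub>L shift_op L i = shift_op L i" "shift_op L i o\<^sub>L proj_op L = shift_op L i"
    by (rule op_eqI; auto simp: proj_op_Rep shift_op_Rep neq_Nil_conv dest: L_ConsD)+
  then show ?thesis by (simp add: bounded_ops_def clinear_shift)
qed

lemma cstar_T_eq: "cstar_T d I = cstar_generated L (insert (proj_op L) (shift_op L ` {1..d}))"
  by (simp add: cstar_T_def Let_def)

lemma cstar_T_gens_bounded: "insert (proj_op L) (shift_op L ` {1..d}) \<subseteq> bounded_ops L"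
  using shift_bounded proj_bounded_ops by blast

lemma cstar_T_subalgebra: "cstar_subalgebra L (cstar_T d I)"
  unfolding cstar_T_eq by (rule cstar_generated_subalgebra[OF cstar_T_gens_bounded])

lemma cstar_T_gens: "proj_op L \<in> cstar_T d I" "i \<in> {1..d} \<Longrightarrow> shift_op L i \<in> cstar_T d I"
  unfolding cstar_T_eq by (auto intro: subsetD[OF cstar_generated_incl])

lemma shift_word_in_cstar_T: "set \<mu> \<subseteq> {1..d} \<Longrightarrow> shift_word L \<mu> \<in> cstar_T d I"
proof (induction \<mu>)
  case Nil
  then show ?case by (simp add: shift_word_def cstar_T_gens)
next
  case (Cons i \<mu>)
  then have "shift_op L i o\<^sub>L shift_word L \<mu> \<in> cstar_T d I"
    by (intro cstar_subalgebraD(4)[OF cstar_T_subalgebra] cstar_T_gens) auto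
  then show ?case by (simp add: shift_word_def)
qed

lemma A_subset_cstar_T: "A \<subseteq> cstar_T d I"
proof -
  have "p \<mu> \<in> cstar_T d I" if "\<mu> \<in> L" for \<mu>
    using shift_word_in_cstar_T[OF L_letters[OF that]] cstar_subalgebraD(4,5)[OF cstar_T_subalgebra]
    by (simp flip: shift_word_proj)
  then show ?thesis
    unfolding A_eq by (intro cstar_generated_least[OF cstar_T_subalgebra]) auto
qed

end

text \<open>\<open>\<sigma>\<close> changes the letters of a word from right to left, the new letter depending on the suffix.
  If this dependence is visible in \<open>A\<close>, the shifts of one language are finite sums of shifts of the
  other one cut down by projections in \<open>A\<close>.\<close>

locale word_relabelling =
  X: quantised_dynamics d I + Y: quantised_dynamics d J
  for d and I J :: "(nat list \<Rightarrow>\<^sub>0 complex) set" +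
  fixes \<sigma> :: "nat list \<Rightarrow> nat list"
  assumes bij: "bij_betw \<sigma> Y.L X.L"
    and relabel_Nil: "\<sigma> [] = []"
    and relabel_Cons: "i # \<nu> \<in> Y.L \<Longrightarrow> \<exists>j. \<sigma> (i # \<nu>) = j # \<sigma> \<nu>"
    and visible: "proj_op {\<nu>. i # \<nu> \<in> Y.L \<and> hd (\<sigma> (i # \<nu>)) = j} \<in> Y.A"
begin

abbreviation "V \<equiv> pull_op Y.L \<sigma>"

lemma inj: "inj_on \<sigma> Y.L" and range: "\<sigma> ` Y.L = X.L"
  using bij by (auto simp: bij_betw_def)

lemma unitary: "unitary_between V X.L Y.L"
  by unfold_locales (simp_all add: clinear_pull adj_pull_pull pull_adj_pull inj range)

text \<open>The operator \<open>V T\<^sub>j V\<^sup>*\<close> maps \<open>e\<^sub>\<nu>\<close> to \<open>e\<^bsub>i\<nu>\<^esub>\<close> for the letter \<open>i\<close> that is relabelled to \<open>j\<close> at \<open>\<nu>\<close>, and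
  to \<open>0\<close> if there is no such letter.\<close>

lemma conj_shift: "unitary_between.conj_op V (shift_op X.L j) \<in> cstar_T d J"
proof -
  interpret V: unitary_between V X.L Y.L by (rule unitary)
  let ?E = "\<lambda>i. {\<nu>. i # \<nu> \<in> Y.L \<and> hd (\<sigma> (i # \<nu>)) = j}"
  let ?a = "\<lambda>i. shift_op Y.L i o\<^sub>L proj_op (?E i)"
  have "V.conj_op (shift_op X.L j) = (\<Sum>i\<in>{1..d}. ?a i)"
  proof (rule op_eqI)
    fix f x
    have sum: "Rep_ell2 ((\<Sum>i\<in>{1..d}. ?a i) f) x = (\<Sum>i\<in>{1..d}. Rep_ell2 (?a i f) x)"
      by (simp add: blinfun.sum_left Rep_ell2_sum)
    show "Rep_ell2 (V.conj_op (shift_op X.L j) f) x = Rep_ell2 ((\<Sum>i\<in>{1..d}. ?a i) f) x"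
    proof (cases "x \<in> Y.L \<and> x \<noteq> []")
      case False
      then show ?thesis
        unfolding sum by (auto simp: V.conj_op_def pull_op_Rep inj shift_op_Rep relabel_Nil)
    next
      case True
      then obtain i \<nu> where x: "x = i # \<nu>" by (cases x) auto
      then obtain k where k: "\<sigma> (i # \<nu>) = k # \<sigma> \<nu>" using relabel_Cons True by blast
      have \<nu>: "\<nu> \<in> Y.L" and i: "i \<in> {1..d}" and kL: "k # \<sigma> \<nu> \<in> X.L"
        using True x k Y.L_ConsD Y.L_letters[of x] range by (blast, auto simp flip: k)
      have "Rep_ell2 (V.conj_op (shift_op X.L j) f) x = (if k = j then Rep_ell2 f \<nu> else 0)"
        using True \<nu> kL by (simp add: x k V.conj_op_def pull_op_Rep inj shift_op_Rep adj_pull_op_Rep)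
      moreover have "(\<Sum>m\<in>{1..d}. Rep_ell2 (?a m f) x) = (\<Sum>m\<in>{1..d}. if m = i then Rep_ell2 (?a i f) x else 0)"
        by (rule sum.cong) (auto simp: x shift_op_Rep)
      moreover have "Rep_ell2 (?a i f) x = (if k = j then Rep_ell2 f \<nu> else 0)"
        using True by (simp add: x k shift_op_Rep proj_op_Rep)
      ultimately show ?thesis using i unfolding sum by simp
    qed
  qed
  moreover have a: "?a i \<in> cstar_T d J" if "i \<in> {1..d}" for i
    using that Y.A_subset_cstar_T visible
    by (intro cstar_subalgebraD(4)[OF Y.cstar_T_subalgebra] Y.cstar_T_gens) auto
  have "S \<subseteq> {1..d} \<longrightarrow> (\<Sum>i\<in>S. ?a i) \<in> cstar_T d J" if "finite S" for S
    using that by (induction S rule: finite_induct)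
      (simp_all add: cstar_subalgebraD(2,3)[OF Y.cstar_T_subalgebra] a)
  ultimately show ?thesis by simp
qed

lemma conj_cstar_T: "a \<in> cstar_T d I \<Longrightarrow> unitary_between.conj_op V a \<in> cstar_T d J"
proof -
  interpret V: unitary_between V X.L Y.L by (rule unitary)
  assume "a \<in> cstar_T d I"
  moreover have "V.conj_op g \<in> cstar_T d J" if "g \<in> insert (proj_op X.L) (shift_op X.L ` {1..d})" for g
    using that conj_shift Y.cstar_T_gens(1) by (auto simp: V.conj_op_one)
  ultimately show ?thesis
    unfolding X.cstar_T_eq
    by (rule V.conj_op_generated[OF X.cstar_T_gens_bounded Y.cstar_T_subalgebra, rotated])
qed

end


section \<open>From conjugate dynamics to a relabelling\<close>

text \<open>The dynamics add letters on the left of a word, so the suffix \<open>\<nu>\<close> is the part that is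
  already relabelled when the map \<open>c \<nu>\<close> acts on the next letter.\<close>

primrec relabel :: "(nat list \<Rightarrow> nat \<Rightarrow> nat) \<Rightarrow> nat list \<Rightarrow> nat list"
  where "relabel c [] = []"
  | "relabel c (i # \<nu>) = c \<nu> i # relabel c \<nu>"

locale conjugate_dynamics =
  X: quantised_dynamics d I + Y: quantised_dynamics d J
  for d and I J :: "(nat list \<Rightarrow>\<^sub>0 complex) set" +
  fixes \<gamma> :: "(word_op \<Rightarrow> complex) \<Rightarrow> (word_op \<Rightarrow> complex)"
  assumes homeo: "homeomorphic_map (Omega d J) (Omega d I) \<gamma>"
    and loc: "\<And>y. y \<in> Y.\<Omega> \<Longrightarrow> \<exists>V \<pi>. openin (Omega d J) V \<and> y \<in> V \<and>
      (\<forall>u\<in>V. bij_betw \<pi> (Y.letters u) (X.letters (\<gamma> u)) \<and>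
        (\<forall>i\<in>Y.letters u. \<gamma> (dyn_map d J i u) = dyn_map d I (\<pi> i) (\<gamma> u)))"
begin

lemma bij_\<gamma>: "bij_betw \<gamma> Y.\<Omega> X.\<Omega>"
  using homeomorphic_imp_injective_map[OF homeo] homeomorphic_imp_surjective_map[OF homeo]
  by (simp add: bij_betw_def X.topspace_Omega Y.topspace_Omega)

lemma \<gamma>_char: "u \<in> Y.\<Omega> \<Longrightarrow> \<gamma> u \<in> X.\<Omega>"
  using bij_\<gamma> by (auto simp: bij_betw_def)

text \<open>The local bijections match the branches at the root of the two trees, and equivariance allows
  to continue at the images under the dynamics.\<close>

lemma card_past_level:
  assumes "u \<in> Y.\<Omega>"
  shows "card (X.past_level n (\<gamma> u)) = card (Y.past_level n u)"
  using assms
proof (induction n arbitrary: u)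
  case 0
  then show ?case using \<gamma>_char by (simp add: X.card_past_level_0 Y.card_past_level_0)
next
  case (Suc n)
  obtain \<pi> where \<pi>: "bij_betw \<pi> (Y.letters u) (X.letters (\<gamma> u))"
      "\<And>i. i \<in> Y.letters u \<Longrightarrow> \<gamma> (dyn_map d J i u) = dyn_map d I (\<pi> i) (\<gamma> u)"
    using loc[OF Suc.prems] by blast
  have "card (X.past_level (Suc n) (\<gamma> u))
      = (\<Sum>i\<in>Y.letters u. card (X.past_level n (dyn_map d I (\<pi> i) (\<gamma> u))))"
    unfolding X.card_past_level_Suc[OF \<gamma>_char[OF Suc.prems]]
    by (rule sum.reindex_bij_betw[OF \<pi>(1), symmetric])
  also have "\<dots> = (\<Sum>i\<in>Y.letters u. card (Y.past_level n (dyn_map d J i u)))"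
  proof (rule sum.cong[OF refl])
    fix i assume i: "i \<in> Y.letters u"
    then have "dyn_map d J i u \<in> Y.\<Omega>"
      using Y.dyn_map_char[OF Suc.prems] by (simp add: Y.letters_def)
    then show "card (X.past_level n (dyn_map d I (\<pi> i) (\<gamma> u))) = card (Y.past_level n (dyn_map d J i u))"
      using Suc.IH[of "dyn_map d J i u"] \<pi>(2)[OF i] by simp
  qed
  finally show ?case unfolding Y.card_past_level_Suc[OF Suc.prems] .
qed

text \<open>The vacuum state has the largest past, namely the whole language. Comparing the number of words
  of each length in both directions shows that its image has the largest past as well.\<close>

lemma \<gamma>_vacuum: "\<gamma> (Y.state []) = X.state []"
proof -
  let ?y = "Y.state []" and ?x = "X.state []"
  have y: "?y \<in> Y.\<Omega>" and x: "?x \<in> X.\<Omega>"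
    by (simp_all add: X.state_char Y.state_char X.Nil_L Y.Nil_L)
  obtain y' where y': "y' \<in> Y.\<Omega>" "\<gamma> y' = ?x"
    using bij_\<gamma> x by (metis bij_betw_imp_surj_on imageE)
  have X_le: "X.past_level n \<omega> \<subseteq> X.past_level n ?x" for n \<omega>
    using X.past_subset by (auto simp: X.past_level_def X.past_state)
  have Y_le: "Y.past_level n \<omega> \<subseteq> Y.past_level n ?y" for n \<omega>
    using Y.past_subset by (auto simp: Y.past_level_def Y.past_state)
  have "X.past_level n (\<gamma> ?y) = X.past_level n ?x" for n
  proof (rule card_subset_eq[OF X.finite_past_level X_le])
    have "card (X.past_level n ?x) = card (Y.past_level n y')"
      using card_past_level[OF y'(1)] y'(2) by simp
    also have "\<dots> \<le> card (Y.past_level n ?y)"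
      by (rule card_mono[OF Y.finite_past_level Y_le])
    also have "\<dots> = card (X.past_level n (\<gamma> ?y))"
      using card_past_level[OF y] by simp
    finally show "card (X.past_level n (\<gamma> ?y)) = card (X.past_level n ?x)"
      using card_mono[OF X.finite_past_level X_le] by (simp add: le_antisym)
  qed
  then have "X.past (\<gamma> ?y) = X.past ?x"
    unfolding X.past_level_def by blast
  then show ?thesis
    by (rule X.char_eqI[OF \<gamma>_char[OF y] x])
qed

text \<open>The relabelling starts at the vacuum and follows the orbit of the vacuum state: the invariant is
  \<open>\<gamma>(\<omega>\<^sub>\<nu>) = \<omega>\<^bsub>\<sigma>(\<nu>)\<^esub>\<close>, called \<open>track\<close> in the proof. It makes the letters that extend \<open>\<nu>\<close> correspond to
  the letters that extend \<open>\<sigma>(\<nu>)\<close>.\<close>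

lemma obtains_relabelling:
  obtains \<sigma> where "word_relabelling d I J \<sigma>" "word_relabelling d J I (inv_into Y.L \<sigma>)"
proof -
  define R where "R u \<pi> \<longleftrightarrow> bij_betw \<pi> (Y.letters u) (X.letters (\<gamma> u)) \<and>
    (\<forall>i\<in>Y.letters u. \<gamma> (dyn_map d J i u) = dyn_map d I (\<pi> i) (\<gamma> u))" for u \<pi>
  have "\<exists>N \<rho>. (\<forall>u\<in>Y.\<Omega>. R u (\<rho> u)) \<and> (\<forall>u\<in>Y.\<Omega>. \<forall>u'\<in>Y.\<Omega>. Y.agree N u u' \<longrightarrow> \<rho> u = \<rho> u')"
    by (rule Y.locally_constant_choice) (use loc in \<open>simp add: R_def\<close>)
  then obtain N \<rho> where R: "\<And>u. u \<in> Y.\<Omega> \<Longrightarrow> R u (\<rho> u)"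
    and \<rho>_agree: "\<And>u u'. u \<in> Y.\<Omega> \<Longrightarrow> u' \<in> Y.\<Omega> \<Longrightarrow> Y.agree N u u' \<Longrightarrow> \<rho> u = \<rho> u'"
    by blast
  (* The set of letters belongs to the data, because a projection cutting down a shift has to see
     both whether a letter can be added and how it is relabelled; words of length 1 reveal it. *)
  define data where "data u = (Y.letters u, \<rho> u)" for u
  have data_agree: "data u = data u'" if "u \<in> Y.\<Omega>" "u' \<in> Y.\<Omega>" "Y.agree (max 1 N) u u'" for u u'
    using \<rho>_agree[OF that(1,2)] Y.agree_letters[OF that(3)] Y.agree_mono[OF _ that(3), of N]
    by (simp add: data_def)

  (* Transporting the data with the inverse of gamma keeps it locally constant, now with respect to
     the past of characters on the other side. *)
  define \<delta> where "\<delta> = inv_into Y.\<Omega> \<gamma>"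
  have \<delta>: "\<delta> x \<in> Y.\<Omega>" "\<gamma> (\<delta> x) = x" if "x \<in> X.\<Omega>" for x
    using that bij_\<gamma> by (auto simp: \<delta>_def bij_betw_def inv_into_into f_inv_into_f)
  have \<delta>_\<gamma>: "\<delta> (\<gamma> u) = u" if "u \<in> Y.\<Omega>" for u
    using that bij_\<gamma> by (auto simp: \<delta>_def bij_betw_def)
  have "\<exists>N' D. (\<forall>x\<in>X.\<Omega>. D x = data (\<delta> x)) \<and>
      (\<forall>x\<in>X.\<Omega>. \<forall>x'\<in>X.\<Omega>. X.agree N' x x' \<longrightarrow> D x = D x')"
  proof (rule X.locally_constant_choice)
    fix x assume x: "x \<in> X.\<Omega>"
    let ?U = "{u \<in> Y.\<Omega>. Y.agree (max 1 N) (\<delta> x) u}"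
    have "openin (Omega d I) (\<gamma> ` ?U)"
      using homeomorphic_imp_open_map[OF homeo] Y.openin_cylinder unfolding open_map_def by blast
    moreover have "x \<in> \<gamma> ` ?U"
      using \<delta>[OF x] Y.agree_refl by (metis (mono_tags, lifting) imageI mem_Collect_eq)
    moreover have "data (\<delta> x) = data (\<delta> x')" if "x' \<in> \<gamma> ` ?U" for x'
      using that data_agree \<delta>[OF x] \<delta>_\<gamma> by auto
    ultimately show "\<exists>V D. openin (Omega d I) V \<and> x \<in> V \<and> (\<forall>x'\<in>V. D = data (\<delta> x'))"
      by blast
  qed
  then obtain N' where data_agree': "\<And>x x'. x \<in> X.\<Omega> \<Longrightarrow> x' \<in> X.\<Omega> \<Longrightarrow> X.agree N' x x' \<Longrightarrow> data (\<delta> x) = data (\<delta> x')"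
    by metis

  define \<sigma> where "\<sigma> = relabel (\<lambda>\<nu>. \<rho> (Y.state \<nu>))"
  have \<sigma>_Nil: "\<sigma> [] = []" and \<sigma>_Cons: "\<sigma> (i # \<nu>) = \<rho> (Y.state \<nu>) i # \<sigma> \<nu>" for i \<nu>
    by (simp_all add: \<sigma>_def)
  have track: "\<sigma> \<nu> \<in> X.L \<and> \<gamma> (Y.state \<nu>) = X.state (\<sigma> \<nu>)" if "\<nu> \<in> Y.L" for \<nu>
    using that
  proof (induction \<nu>)
    case Nil
    then show ?case by (simp add: \<sigma>_Nil X.Nil_L \<gamma>_vacuum)
  next
    case (Cons i \<nu>)
    let ?u = "Y.state \<nu>" and ?j = "\<rho> (Y.state \<nu>) i"
    have \<nu>: "\<nu> \<in> Y.L" using Cons.prems by (rule Y.L_ConsD)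
    then have IH: "\<sigma> \<nu> \<in> X.L" "\<gamma> ?u = X.state (\<sigma> \<nu>)" using Cons.IH by auto
    have i: "i \<in> Y.letters ?u" using Cons.prems by (simp add: Y.letters_state)
    have "R ?u (\<rho> ?u)" using R Y.state_char[OF \<nu>] .
    then have "?j \<in> X.letters (\<gamma> ?u)" "\<gamma> (dyn_map d J i ?u) = dyn_map d I ?j (\<gamma> ?u)"
      using i by (auto simp: R_def bij_betw_def)
    then show ?case
      using Cons.prems by (simp add: \<sigma>_Cons IH X.letters_state X.dyn_map_state Y.dyn_map_state)
  qed
  have \<pi>_bij: "bij_betw (\<rho> (Y.state \<nu>)) {i. i # \<nu> \<in> Y.L} {j. j # \<sigma> \<nu> \<in> X.L}" if "\<nu> \<in> Y.L" for \<nu>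
    using R[OF Y.state_char[OF that]] track[OF that] by (simp add: R_def X.letters_state Y.letters_state)
  have inj: "\<nu> = \<nu>'" if "\<nu> \<in> Y.L" "\<nu>' \<in> Y.L" "\<sigma> \<nu> = \<sigma> \<nu>'" for \<nu> \<nu>'
    using that
  proof (induction \<nu> arbitrary: \<nu>')
    case Nil
    then show ?case by (cases \<nu>') (simp_all add: \<sigma>_Nil \<sigma>_Cons)
  next
    case (Cons i \<nu>)
    then obtain i' \<kappa> where \<nu>': "\<nu>' = i' # \<kappa>" by (cases \<nu>') (simp_all add: \<sigma>_Nil \<sigma>_Cons)
    then have "\<nu> = \<kappa>"
      using Cons.IH[of \<kappa>] Cons.prems Y.L_ConsD by (auto simp: \<sigma>_Cons)
    moreover have "i = i'"
      using \<pi>_bij[of \<nu>] Cons.prems Y.L_ConsD unfolding \<nu>' \<open>\<nu> = \<kappa>\<close> \<sigma>_Cons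
      by (auto simp: bij_betw_def inj_on_def)
    ultimately show ?case using \<nu>' by simp
  qed
  have "\<mu> \<in> \<sigma> ` Y.L" if "\<mu> \<in> X.L" for \<mu>
    using that
  proof (induction \<mu>)
    case Nil
    then show ?case using \<sigma>_Nil Y.Nil_L by (metis imageI)
  next
    case (Cons j \<mu>)
    then obtain \<nu> where \<nu>: "\<nu> \<in> Y.L" "\<mu> = \<sigma> \<nu>" using X.L_ConsD by blast
    then have "j \<in> \<rho> (Y.state \<nu>) ` {i. i # \<nu> \<in> Y.L}"
      using \<pi>_bij[OF \<nu>(1)] Cons.prems by (simp add: bij_betw_def)
    then show ?case using \<nu>(2) \<sigma>_Cons by (auto intro!: image_eqI)
  qed
  then have bij: "bij_betw \<sigma> Y.L X.L"
    using inj track by (auto simp: bij_betw_def inj_on_def)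
  let ?\<tau> = "inv_into Y.L \<sigma>"
  have \<tau>_\<sigma>: "?\<tau> (\<sigma> \<nu>) = \<nu>" if "\<nu> \<in> Y.L" for \<nu>
    using that bij by (simp add: bij_betw_def)
  have \<sigma>_\<tau>: "?\<tau> \<mu> \<in> Y.L" "\<sigma> (?\<tau> \<mu>) = \<mu>" if "\<mu> \<in> X.L" for \<mu>
    using that bij by (auto simp: bij_betw_def inv_into_into f_inv_into_f)
  have \<tau>_Cons: "\<exists>i. ?\<tau> (j # \<mu>) = i # ?\<tau> \<mu> \<and> i # ?\<tau> \<mu> \<in> Y.L \<and> \<rho> (Y.state (?\<tau> \<mu>)) i = j"
    if j\<mu>: "j # \<mu> \<in> X.L" for j \<mu>
  proof -
    obtain i \<nu> where \<nu>: "?\<tau> (j # \<mu>) = i # \<nu>"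
      using \<sigma>_\<tau>(2)[OF j\<mu>] \<sigma>_Nil by (cases "?\<tau> (j # \<mu>)") auto
    then have "i # \<nu> \<in> Y.L" "\<rho> (Y.state \<nu>) i = j" "\<sigma> \<nu> = \<mu>"
      using \<sigma>_\<tau>[OF j\<mu>] by (auto simp: \<sigma>_Cons)
    then show ?thesis using \<nu> \<tau>_\<sigma> Y.L_ConsD by auto
  qed

  have "word_relabelling d I J \<sigma>"
  proof (unfold_locales)
    show "bij_betw \<sigma> Y.L X.L" by (rule bij)
    show "\<sigma> [] = []" by (rule \<sigma>_Nil)
    show "\<exists>j. \<sigma> (i # \<nu>) = j # \<sigma> \<nu>" for i \<nu> by (simp add: \<sigma>_Cons)
    show "proj_op {\<nu>. i # \<nu> \<in> Y.L \<and> hd (\<sigma> (i # \<nu>)) = j} \<in> Y.A" for i j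
    proof (rule Y.proj_saturated[of _ "max 1 N"])
      fix \<nu> \<nu>' assume *: "\<nu> \<in> {\<nu>. i # \<nu> \<in> Y.L \<and> hd (\<sigma> (i # \<nu>)) = j}" "\<nu>' \<in> Y.L"
        "Y.agree (max 1 N) (Y.state \<nu>) (Y.state \<nu>')"
      then have "data (Y.state \<nu>) = data (Y.state \<nu>')"
        using Y.L_ConsD by (intro data_agree Y.state_char) auto
      then show "\<nu>' \<in> {\<nu>. i # \<nu> \<in> Y.L \<and> hd (\<sigma> (i # \<nu>)) = j}"
        using *(1) by (auto simp: data_def \<sigma>_Cons Y.letters_state)
    qed (use Y.L_ConsD in auto)
  qed
  moreover have "word_relabelling d J I ?\<tau>"
  proof (unfold_locales)
    show "bij_betw ?\<tau> X.L Y.L" using bij by (rule bij_betw_inv_into)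
    show "?\<tau> [] = []" using \<tau>_\<sigma>[OF Y.Nil_L] by (simp add: \<sigma>_Nil)
    show "\<exists>i. ?\<tau> (j # \<mu>) = i # ?\<tau> \<mu>" if "j # \<mu> \<in> X.L" for j \<mu>
      using \<tau>_Cons[OF that] by blast
    show "proj_op {\<mu>. j # \<mu> \<in> X.L \<and> hd (?\<tau> (j # \<mu>)) = i} \<in> X.A" for i j
    proof (rule X.proj_saturated[of _ N'])
      fix \<mu> \<mu>' assume *: "\<mu> \<in> {\<mu>. j # \<mu> \<in> X.L \<and> hd (?\<tau> (j # \<mu>)) = i}" "\<mu>' \<in> X.L"
        "X.agree N' (X.state \<mu>) (X.state \<mu>')"
      have \<mu>: "\<mu> \<in> X.L" using *(1) X.L_ConsD by blast
      have state: "\<delta> (X.state \<kappa>) = Y.state (?\<tau> \<kappa>)" if "\<kappa> \<in> X.L" for \<kappa>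
        using track[OF \<sigma>_\<tau>(1)[OF that]] \<sigma>_\<tau>[OF that] \<delta>_\<gamma>[OF Y.state_char] by metis
      have "data (Y.state (?\<tau> \<mu>)) = data (Y.state (?\<tau> \<mu>'))"
        using data_agree'[OF X.state_char[OF \<mu>] X.state_char[OF *(2)] *(3)] state \<mu> *(2) by simp
      moreover have "i # ?\<tau> \<mu> \<in> Y.L" "\<rho> (Y.state (?\<tau> \<mu>)) i = j"
        using \<tau>_Cons[of j \<mu>] *(1) by auto
      ultimately have i: "i # ?\<tau> \<mu>' \<in> Y.L" "\<sigma> (i # ?\<tau> \<mu>') = j # \<mu>'"
        using \<sigma>_\<tau>(2)[OF *(2)] by (auto simp: data_def Y.letters_state \<sigma>_Cons)
      then show "\<mu>' \<in> {\<mu>. j # \<mu> \<in> X.L \<and> hd (?\<tau> (j # \<mu>)) = i}"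
        using track[OF i(1)] \<tau>_\<sigma>[OF i(1)] by auto
    qed (use X.L_ConsD in auto)
  qed
  ultimately show ?thesis by (rule that)
qed

end

text \<open>On a piece contained in \<open>P\<^sub>S\<close> and mapped into \<open>Q\<^bsub>S'\<^esub>\<close> the sets \<open>S\<close> and \<open>S'\<close> are recovered from
  each single point as its letters.\<close>

lemma QP_imp_conjugate_dynamics:
  assumes "monomial_ideal d I" "monomial_ideal d J" "QP_locally_piecewise_conjugate d I d J"
  shows "\<exists>\<gamma>. conjugate_dynamics d I J \<gamma>"
proof -
  interpret X: quantised_dynamics d I by unfold_locales (rule assms(1))
  interpret Y: quantised_dynamics d J by unfold_locales (rule assms(2))
  obtain \<gamma> where homeo: "homeomorphic_map (Omega d J) (Omega d I) \<gamma>"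
    and loc: "\<forall>S \<subseteq> {1..d}. \<forall>y \<in> Q_set d J S.
        \<exists>U \<subseteq> Q_set d J S. (\<exists>V. openin (Omega d J) V \<and> y \<in> V \<and> V \<subseteq> U) \<and>
          (\<exists>S' \<subseteq> {1..d}. card S' = card S \<and> \<gamma> ` U \<subseteq> Q_set d I S' \<and>
            (\<exists>\<pi>. bij_betw \<pi> S S' \<and>
              (\<forall>i\<in>S. \<forall>u\<in>U. \<gamma> (dyn_map d J i u) = dyn_map d I (\<pi> i) (\<gamma> u))))"
    using assms(3)[unfolded QP_locally_piecewise_conjugate_def] by (elim conjE exE) (rule that)
  have "conjugate_dynamics d I J \<gamma>"
  proof unfold_locales
    fix y assume y: "y \<in> Y.\<Omega>"
    let ?S = "Y.letters y"
    have S: "?S \<subseteq> {1..d}" by (rule Y.letters_subset)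
    have "y \<in> Q_set d J ?S" using y by (simp add: Y.Q_set_iff[OF S])
    from loc[rule_format, OF S this] obtain U V S' \<pi> where
      U: "U \<subseteq> Q_set d J ?S" and V: "openin (Omega d J) V" "y \<in> V" "V \<subseteq> U" and
      S': "S' \<subseteq> {1..d}" "\<gamma> ` U \<subseteq> Q_set d I S'" and
      \<pi>: "bij_betw \<pi> ?S S'" "\<forall>i\<in>?S. \<forall>u\<in>U. \<gamma> (dyn_map d J i u) = dyn_map d I (\<pi> i) (\<gamma> u)"
      by blast
    have letters: "Y.letters u = ?S" "X.letters (\<gamma> u) = S'" if "u \<in> V" for u
    proof -
      have "u \<in> Q_set d J ?S" "\<gamma> u \<in> Q_set d I S'" using that U V(3) S'(2) by blast+
      then show "Y.letters u = ?S" "X.letters (\<gamma> u) = S'"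
        by (simp_all only: Y.Q_set_iff[OF S] X.Q_set_iff[OF S'(1)])
    qed
    show "\<exists>V \<pi>. openin (Omega d J) V \<and> y \<in> V \<and>
      (\<forall>u\<in>V. bij_betw \<pi> (Y.letters u) (X.letters (\<gamma> u)) \<and>
        (\<forall>i\<in>Y.letters u. \<gamma> (dyn_map d J i u) = dyn_map d I (\<pi> i) (\<gamma> u)))"
    proof (intro exI conjI ballI)
      show "openin (Omega d J) V" "y \<in> V" by (fact V)+
      fix u assume u: "u \<in> V"
      show "bij_betw \<pi> (Y.letters u) (X.letters (\<gamma> u))"
        using \<pi>(1) by (simp only: letters[OF u])
      fix i assume "i \<in> Y.letters u"
      then have "i \<in> ?S" by (simp only: letters[OF u])
      then show "\<gamma> (dyn_map d J i u) = dyn_map d I (\<pi> i) (\<gamma> u)"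
        using \<pi>(2) u V(3) by blast
    qed
  qed (rule homeo)
  then show ?thesis by (rule exI[of _ \<gamma>])
qed

theorem corollary8p19:
  fixes d d' :: nat and I J :: "(nat list \<Rightarrow>\<^sub>0 complex) set"
  assumes "monomial_ideal d I" and "monomial_ideal d' J"
    and "QP_locally_piecewise_conjugate d I d' J"
  shows "cstar_T_algebra d I \<simeq>\<^sub>* cstar_T_algebra d' J
    \<and> quotient_star_algebra (cstar_T_algebra d I) (compact_ops (allowed_words d I))
      \<simeq>\<^sub>* quotient_star_algebra (cstar_T_algebra d' J) (compact_ops (allowed_words d' J))"
proof -
  have d': "d' = d" using assms(3) by (simp add: QP_locally_piecewise_conjugate_def)
  obtain \<gamma> where "conjugate_dynamics d I J \<gamma>"
    using QP_imp_conjugate_dynamics assms unfolding d' by blast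
  then obtain \<sigma> where \<sigma>: "word_relabelling d I J \<sigma>"
    and \<tau>: "word_relabelling d J I (inv_into (allowed_words d J) \<sigma>)"
    by (rule conjugate_dynamics.obtains_relabelling)
  interpret XY: word_relabelling d I J \<sigma> by (rule \<sigma>)
  interpret YX: word_relabelling d J I "inv_into XY.Y.L \<sigma>" by (rule \<tau>)
  have adj_V: "adj XY.V = YX.V"
    using adj_pull_op[OF XY.inj] by (simp only: XY.range)
  show ?thesis
    unfolding d' cstar_T_algebra_def
    using star_isomorphic_by_conjugation[OF XY.unitary XY.X.cstar_T_subalgebra XY.Y.cstar_T_subalgebra
        XY.conj_cstar_T YX.conj_cstar_T[folded adj_V]]
    by blast
qed

end
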